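(* Let $\ell$ be a prime, $\mathfrak L$ a place of $\overline{\mathbb Q}$ above $\ell$, and $N$ a positive integer. Let $k_A$ be a positive integer and let $\chi_A$ be a Dirichlet character modulo $N$. Let $A\in\mathrm M_{k_A}(N,\chi_A)$ be such that $A$ and $\frac1{k_A}\theta A$ have $\mathfrak L$-integral Fourier coefficients and satisfy $$A\equiv1\pmod{\mathfrak L},\qquad\frac1{k_A}\theta A\equiv0\pmod{\mathfrak L},\qquad\chi_A\equiv\bar\chi_\ell^{-k_A}\pmod{\mathfrak L}.$$ Then there is a well-defined operator $\tilde\theta_A$ on $\mathrm M(N)$ given by $\tilde\theta_Ag=-\frac1{k_A}[g,A]$. For every $g\in\mathrm M_k(N,\varepsilon)$ with $\mathfrak L$-integral Fourier coefficients, this operator satisfies the following properties: - $\tilde\theta_Ag\in\mathrm M_{k+k_A+2}(N,\varepsilon\chi_A)$ and $\tilde\theta_Ag$ has $\mathfrak L$-integral Fourier coefficients; - $\tilde\theta_Ag\equiv\theta g\pmod{\mathfrak L}$; - moreover, if for some prime number $p$ the form $g$ is a normalised eigenform for $T_p^N$ modulo $\mathfrak L$, then $\tilde\theta_Ag$ is also a normalised eigenform for $T_p^N$ modulo $\mathfrak L$, with eigenvalue (the reduction modulo $\mathfrak L$ of) $pa_p(g)$.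
   Context: $\overline{\mathbb Q}$ is the algebraic closure of $\mathbb Q$ in $\mathbb C$. A place $\mathfrak L$ above $\ell$ is a maximal ideal of the ring of algebraic integers containing $\ell$; $\mathfrak L$-integrality and congruences are with respect to the corresponding valuation, with residue field $\overline{\mathbb F}_\ell$. $\mathrm M_k(N,\varepsilon)$ is the complex space of modular forms of weight $k$, level $N$, character $\varepsilon$ (a Dirichlet character mod $N$), and $\mathrm M(N)$ is the graded algebra of modular forms of level $N$. The $q$-expansion at infinity of $g$ is $\sum_{n\ge0}a_n(g)q^n$. Congruences between forms (or $q$-expansions) mod $\mathfrak L$ mean congruences of all Fourier coefficients. $\theta=\frac1{2i\pi}\frac{d}{dz}=q\frac{d}{dq}$, mapping $\sum a_nq^n$ to $\sum na_nq^n$. For modular forms $g,h$ of weights $k_g,k_h$, the Rankin–Cohen bracket is $[g,h]=k_g\,g\,\theta h-k_h\,h\,\theta g$ (extended bilinearly). $\bar\chi_\ell$ is the mod $\ell$ cyclotomic character; $\chi_A\equiv\bar\chi_\ell^{-k_A}\pmod{\mathfrak L}$ means $\chi_A(n)n^{k_A}\equiv1\pmod{\mathfrak L}$ for all integers $n$ prime to $N\ell$. $T_p^N$ is the $p$-th Hecke operator on $\mathrm M(N)$; on $\mathrm M_k(N,\varepsilon)$, $a_n(T_p^Ng)=a_{np}(g)+p^{k-1}\varepsilon(p)a_{n/p}(g)$ with $a_{n/p}=0$ if $p\nmid n$ (and $\varepsilon(p)=0$ if $p\mid N$). A form $g$ is an eigenform for $T_p^N$ modulo $\mathfrak L$ with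 eigenvalue $a_p\in\overline{\mathbb F}_\ell$ if $g$ has $\mathfrak L$-integral Fourier coefficients and $T_p^Ng$ is congruent to $a_pg$ modulo $\mathfrak L$; it is normalised modulo $\mathfrak L$ if $a_1(g)\equiv1\pmod{\mathfrak L}$. *)

theory Defs
  imports "HOL-Complex_Analysis.Complex_Analysis" "HOL-Algebra.QuotRing"
begin

section \<open>Places of the field of algebraic numbers\<close>

definition algint_ring :: "complex ring" where
  "algint_ring = \<lparr>carrier = {x. algebraic_int x}, monoid.mult = (*), one = 1, zero = 0, add = (+)\<rparr>"

definition place_above :: "nat \<Rightarrow> complex set \<Rightarrow> bool" where
  "place_above l L \<longleftrightarrow> maximalideal L algint_ring \<and> of_nat l \<in> L"

text \<open>
  The valuation ring attached to a place \<open>L\<close> is the localisation at \<open>L\<close> of the ring of algebraic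
  integers; its maximal ideal is the extension of \<open>L\<close>.
\<close>

definition L_integers :: "complex set \<Rightarrow> complex set" where
  "L_integers L = {x / s | x s. algebraic_int x \<and> algebraic_int s \<and> s \<notin> L}"

definition L_maximal :: "complex set \<Rightarrow> complex set" where
  "L_maximal L = {x / s | x s. x \<in> L \<and> algebraic_int s \<and> s \<notin> L}"

definition L_cong :: "complex set \<Rightarrow> complex \<Rightarrow> complex \<Rightarrow> bool" where
  "L_cong L x y \<longleftrightarrow> x - y \<in> L_maximal L"

definition L_ring :: "complex set \<Rightarrow> complex ring" where
  "L_ring L = \<lparr>carrier = L_integers L, monoid.mult = (*), one = 1, zero = 0, add = (+)\<rparr>"

definition residue_field :: "complex set \<Rightarrow> complex set ring" where
  "residue_field L = L_ring L Quot L_maximal L"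

definition reduction :: "complex set \<Rightarrow> complex \<Rightarrow> complex set" where
  "reduction L x = L_maximal L +>\<^bsub>L_ring L\<^esub> x"


section \<open>Modular forms\<close>

definition dirichlet_char :: "nat \<Rightarrow> (int \<Rightarrow> complex) \<Rightarrow> bool" where
  "dirichlet_char N \<psi> \<longleftrightarrow>
     (\<forall>n. \<psi> (n + int N) = \<psi> n) \<and>
     (\<forall>m n. \<psi> (m * n) = \<psi> m * \<psi> n) \<and>
     (\<forall>n. \<psi> n = 0 \<longleftrightarrow> \<not> coprime n (int N))"

definition upper_half :: "complex set" where
  "upper_half = {z. Im z > 0}"

definition mobius :: "int \<Rightarrow> int \<Rightarrow> int \<Rightarrow> int \<Rightarrow> complex \<Rightarrow> complex" where
  "mobius a b c d z = (of_int a * z + of_int b) / (of_int c * z + of_int d)"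

definition slash ::
  "nat \<Rightarrow> int \<Rightarrow> int \<Rightarrow> int \<Rightarrow> int \<Rightarrow> (complex \<Rightarrow> complex) \<Rightarrow> complex \<Rightarrow> complex" where
  "slash k a b c d f z = f (mobius a b c d z) / (of_int c * z + of_int d) ^ k"

text \<open>
  Functions on the upper half plane are encoded as functions on \<open>complex\<close> that vanish outside it, so
  that equality of forms is equality of functions.  Holomorphy at the cusps is expressed as boundedness
  near \<open>i\<infinity>\<close> of all translates under \<open>SL\<^sub>2(\<int>)\<close>.
\<close>

definition holo_with_cusps :: "nat \<Rightarrow> (complex \<Rightarrow> complex) \<Rightarrow> bool" where
  "holo_with_cusps k f \<longleftrightarrow>
     f holomorphic_on upper_half \<and> (\<forall>z. z \<notin> upper_half \<longrightarrow> f z = 0) \<and>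
     (\<forall>a b c d. a * d - b * c = 1 \<longrightarrow> (\<exists>Y. bounded (slash k a b c d f ` {z. Im z > Y})))"

definition modforms_char :: "nat \<Rightarrow> nat \<Rightarrow> (int \<Rightarrow> complex) \<Rightarrow> (complex \<Rightarrow> complex) set" where
  "modforms_char k N \<epsilon> =
     {f. holo_with_cusps k f \<and>
         (\<forall>a b c d. a * d - b * c = 1 \<longrightarrow> int N dvd c \<longrightarrow>
            (\<forall>z\<in>upper_half. slash k a b c d f z = \<epsilon> d * f z))}"

text \<open>Forms of weight \<open>k\<close> and level \<open>N\<close> without specified character: forms for \<open>\<Gamma>\<^sub>1(N)\<close>.\<close>

definition modforms :: "nat \<Rightarrow> nat \<Rightarrow> (complex \<Rightarrow> complex) set" where
  "modforms k N =
     {f. holo_with_cusps k f \<and>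
         (\<forall>a b c d. a * d - b * c = 1 \<longrightarrow> int N dvd c \<longrightarrow> int N dvd a - 1 \<longrightarrow> int N dvd d - 1 \<longrightarrow>
            (\<forall>z\<in>upper_half. slash k a b c d f z = f z))}"

definition homogeneous_decomp ::
  "nat \<Rightarrow> (complex \<Rightarrow> complex) \<Rightarrow> (nat \<Rightarrow> complex \<Rightarrow> complex) \<Rightarrow> bool" where
  "homogeneous_decomp N g F \<longleftrightarrow>
     (\<forall>k. F k \<in> modforms k N) \<and> finite {k. F k \<noteq> (\<lambda>_. 0)} \<and>
     g = (\<lambda>z. \<Sum>k | F k \<noteq> (\<lambda>_. 0). F k z)"

text \<open>
  The graded algebra \<open>M(N)\<close>, as the internal sum of its homogeneous parts inside the algebra of
  functions on the upper half plane.
\<close>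

definition modforms_alg :: "nat \<Rightarrow> (complex \<Rightarrow> complex) set" where
  "modforms_alg N = {g. \<exists>F. homogeneous_decomp N g F}"

definition component :: "nat \<Rightarrow> (complex \<Rightarrow> complex) \<Rightarrow> nat \<Rightarrow> complex \<Rightarrow> complex" where
  "component N g = (THE F. homogeneous_decomp N g F)"


section \<open>Fourier coefficients\<close>

definition qcoeff :: "(complex \<Rightarrow> complex) \<Rightarrow> nat \<Rightarrow> complex" where
  "qcoeff g = (THE a. \<forall>z\<in>upper_half.
     (\<lambda>n. a n * exp (2 * of_real pi * \<i> * z) ^ n) sums g z)"

definition L_integral_coeffs :: "complex set \<Rightarrow> (complex \<Rightarrow> complex) \<Rightarrow> bool" where
  "L_integral_coeffs L g \<longleftrightarrow> (\<forall>n. qcoeff g n \<in> L_integers L)"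

definition form_cong :: "complex set \<Rightarrow> (complex \<Rightarrow> complex) \<Rightarrow> (complex \<Rightarrow> complex) \<Rightarrow> bool" where
  "form_cong L g h \<longleftrightarrow> (\<forall>n. L_cong L (qcoeff g n) (qcoeff h n))"


section \<open>Operators\<close>

definition theta :: "(complex \<Rightarrow> complex) \<Rightarrow> complex \<Rightarrow> complex" where
  "theta g z = (if z \<in> upper_half then deriv g z / (2 * \<i> * of_real pi) else 0)"

definition homogeneous_bracket ::
  "nat \<Rightarrow> (complex \<Rightarrow> complex) \<Rightarrow> nat \<Rightarrow> (complex \<Rightarrow> complex) \<Rightarrow> complex \<Rightarrow> complex" where
  "homogeneous_bracket kg g kh h z = of_nat kg * g z * theta h z - of_nat kh * h z * theta g z"

definition rankin_cohen ::
  "nat \<Rightarrow> (complex \<Rightarrow> complex) \<Rightarrow> (complex \<Rightarrow> complex) \<Rightarrow> complex \<Rightarrow> complex" where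
  "rankin_cohen N g h z =
     (\<Sum>i | component N g i \<noteq> (\<lambda>_. 0). \<Sum>j | component N h j \<noteq> (\<lambda>_. 0).
        homogeneous_bracket i (component N g i) j (component N h j) z)"

definition theta_tilde ::
  "nat \<Rightarrow> nat \<Rightarrow> (complex \<Rightarrow> complex) \<Rightarrow> (complex \<Rightarrow> complex) \<Rightarrow> complex \<Rightarrow> complex" where
  "theta_tilde N kA A g z = - (1 / of_nat kA) * rankin_cohen N g A z"

text \<open>
  The Hecke operator \<open>T\<^sub>p\<close> on forms of weight \<open>k\<close> and character \<open>\<epsilon>\<close> modulo \<open>N\<close>; the level enters
  through \<open>\<epsilon>\<close>, which vanishes at \<open>p\<close> if \<open>p\<close> divides \<open>N\<close>.  The exponent \<open>k - 1\<close> is an integer,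
  equal to \<open>-1\<close> in weight \<open>0\<close>.
\<close>

definition hecke ::
  "nat \<Rightarrow> (int \<Rightarrow> complex) \<Rightarrow> nat \<Rightarrow> (complex \<Rightarrow> complex) \<Rightarrow> complex \<Rightarrow> complex" where
  "hecke k \<epsilon> p g z = (if z \<in> upper_half then
     (\<Sum>n. (qcoeff g (n * p) + of_nat p powi (int k - 1) * \<epsilon> (int p) *
             (if p dvd n then qcoeff g (n div p) else 0)) * exp (2 * of_real pi * \<i> * z) ^ n)
     else 0)"

definition eigenform_mod ::
  "complex set \<Rightarrow> nat \<Rightarrow> (int \<Rightarrow> complex) \<Rightarrow> nat \<Rightarrow> (complex \<Rightarrow> complex) \<Rightarrow> complex set \<Rightarrow> bool" where
  "eigenform_mod L k \<epsilon> p g ev \<longleftrightarrow>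
     L_integral_coeffs L g \<and> ev \<in> carrier (residue_field L) \<and>
     (\<forall>n. reduction L (qcoeff (hecke k \<epsilon> p g) n)
            = ev \<otimes>\<^bsub>residue_field L\<^esub> reduction L (qcoeff g n))"

definition normalised_mod :: "complex set \<Rightarrow> (complex \<Rightarrow> complex) \<Rightarrow> bool" where
  "normalised_mod L g \<longleftrightarrow> L_cong L (qcoeff g 1) 1"

end

theory Submission
  imports Defs "HOL-Number_Theory.Residues"
begin

text \<open>
  The operator is explicit on a form \<open>g\<close> of weight \<open>k\<close>: it is \<open>A \<theta>g - k g (\<theta>A / k\<^sub>A)\<close>.  As
  \<open>A \<equiv> 1\<close> and \<open>\<theta>A / k\<^sub>A \<equiv> 0\<close>, its \<open>q\<close>-expansion, computed by Cauchy products, is integral and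
  congruent to that of \<open>\<theta>g\<close> (\<open>has_q_expansion_bracket\<close>, \<open>L_cong_convolution\<close>).

  That the result is a modular form is the covariance of the Rankin--Cohen bracket
  (\<open>bracket_slash\<close>): the derivatives of \<open>f\<bar>\<gamma>\<close> and \<open>g\<bar>\<gamma>\<close> contain terms with the derivative of the
  automorphy factor, and these cancel in the bracket.  Covariance under the whole modular group
  reduces the growth condition at the cusps to \<open>i\<infinity>\<close>, where Cauchy's estimate bounds \<open>\<theta>f\<close>
  (\<open>bounded_theta\<close>).  The operator is well defined on the graded algebra because forms of
  different weights are linearly independent: along the lower unipotent matrices of level \<open>N\<close>, a
  relation between them is a polynomial identity in the automorphy factor (\<open>modforms_independent\<close>).

  For the Hecke operators, let \<open>c\<^sub>n \<equiv> n a\<^sub>n\<close> be the coefficients of the new form.  Then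
  \<open>c\<^bsub>np\<^esub> + p\<^bsup>k+1\<^esup> \<epsilon>(p) p\<^bsup>kA\<^esup> \<chi>\<^sub>A(p) c\<^bsub>n/p\<^esub>\<close> is congruent to
  \<open>n p (a\<^bsub>np\<^esub> + p\<^bsup>k-1\<^esup> \<epsilon>(p) a\<^bsub>n/p\<^esub>)\<close>, hence to \<open>p a\<^sub>p c\<^sub>n\<close>, as soon as
  \<open>p \<epsilon>(p) p\<^bsup>kA\<^esup> \<chi>\<^sub>A(p) \<equiv> p \<epsilon>(p)\<close>.  This last congruence holds for every prime \<open>p\<close>: for
  \<open>p\<close> dividing \<open>N\<close> both sides vanish, for \<open>p = \<ell>\<close> both are divisible by \<open>\<ell>\<close>, and otherwise
  it is the hypothesis on \<open>\<chi>\<^sub>A\<close> (\<open>character_twist\<close>, \<open>hecke_eigenvalue_twist\<close>).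
\<close>

section \<open>The valuation ring of a place\<close>

locale algebraic_place =
  fixes L :: "complex set"
  assumes maximal: "maximalideal L algint_ring"
begin

lemma algint_cring: "cring algint_ring"
proof -
  interpret maximalideal L algint_ring by (rule maximal)
  have "ring algint_ring" by (rule ring_axioms)
  then show ?thesis
    by (intro cring.intro comm_monoid.intro) 
       (auto simp: ring_def comm_monoid_axioms_def algint_ring_def mult.commute)
qed

text \<open>
  That sums and products of algebraic integers are algebraic integers is part of the
  hypothesis that \<open>L\<close> is an ideal of a ring.
\<close>

lemma algint_add: "algebraic_int x \<Longrightarrow> algebraic_int y \<Longrightarrow> algebraic_int (x + y :: complex)"
  and algint_mult: "algebraic_int x \<Longrightarrow> algebraic_int y \<Longrightarrow> algebraic_int (x * y :: complex)"
proof -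
  interpret cring algint_ring by (rule algint_cring)
  show "algebraic_int x \<Longrightarrow> algebraic_int y \<Longrightarrow> algebraic_int (x + y)"
    using a_closed[of x y] by (simp add: algint_ring_def)
  show "algebraic_int x \<Longrightarrow> algebraic_int y \<Longrightarrow> algebraic_int (x * y)"
    using m_closed[of x y] by (simp add: algint_ring_def)
qed

lemma place_subset: "x \<in> L \<Longrightarrow> algebraic_int x"
proof -
  interpret maximalideal L algint_ring by (rule maximal)
  show "x \<in> L \<Longrightarrow> algebraic_int x"
    using a_subset by (auto simp: algint_ring_def)
qed

lemma place_zero: "0 \<in> L"
  and place_add: "x \<in> L \<Longrightarrow> y \<in> L \<Longrightarrow> x + y \<in> L"
  and place_mult: "x \<in> L \<Longrightarrow> algebraic_int y \<Longrightarrow> x * y \<in> L"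
proof -
  interpret maximalideal L algint_ring by (rule maximal)
  show "0 \<in> L"
    using additive_subgroup.zero_closed[OF additive_subgroup_axioms] by (simp add: algint_ring_def)
  show "x \<in> L \<Longrightarrow> y \<in> L \<Longrightarrow> x + y \<in> L"
    using additive_subgroup.a_closed[OF additive_subgroup_axioms, of x y] by (simp add: algint_ring_def)
  show "x \<in> L \<Longrightarrow> algebraic_int y \<Longrightarrow> x * y \<in> L"
    using I_r_closed[of x y] by (simp add: algint_ring_def)
qed

lemma place_prime:
  assumes "algebraic_int x" "algebraic_int y" "x * y \<in> L"
  shows "x \<in> L \<or> y \<in> L"
proof -
  interpret cring algint_ring by (rule algint_cring)
  interpret primeideal L algint_ring by (rule maximalideal_prime[OF maximal])
  show ?thesis using I_prime[of x y] assms by (simp add: algint_ring_def)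
qed

lemma one_notin_place: "1 \<notin> L"
proof
  assume "1 \<in> L"
  then have "algebraic_int x \<Longrightarrow> x \<in> L" for x
    using place_mult[of 1 x] by simp
  with place_subset have "carrier algint_ring = L"
    by (auto simp: algint_ring_def)
  with maximalideal.I_notcarr[OF maximal] show False by simp
qed

lemma common_denominator:
  assumes "algebraic_int s" "s \<notin> L" "algebraic_int t" "t \<notin> L"
  shows "algebraic_int (s * t)" "s * t \<notin> L" "s \<noteq> 0" "t \<noteq> 0"
  using assms place_prime algint_mult place_zero by blast+

lemma L_integers_algint: "algebraic_int x \<Longrightarrow> x \<in> L_integers L"
  unfolding L_integers_def using one_notin_place by (force intro: exI[of _ 1])

lemma L_integers_add:
  assumes "x \<in> L_integers L" "y \<in> L_integers L"
  shows "x + y \<in> L_integers L"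
proof -
  obtain a s b t where *: "x = a / s" "y = b / t" "algebraic_int a" "algebraic_int b"
      "algebraic_int s" "s \<notin> L" "algebraic_int t" "t \<notin> L"
    using assms unfolding L_integers_def by blast
  note d = common_denominator[OF *(5-8)]
  have "x + y = (a * t + b * s) / (s * t)"
    using d by (simp add: * field_simps)
  moreover have "algebraic_int (a * t + b * s)"
    using * by (intro algint_add algint_mult)
  ultimately show ?thesis
    unfolding L_integers_def using d by blast
qed

lemma L_integers_mult:
  assumes "x \<in> L_integers L" "y \<in> L_integers L"
  shows "x * y \<in> L_integers L"
proof -
  obtain a s b t where *: "x = a / s" "y = b / t" "algebraic_int a" "algebraic_int b"
      "algebraic_int s" "s \<notin> L" "algebraic_int t" "t \<notin> L"
    using assms unfolding L_integers_def by blast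
  note d = common_denominator[OF *(5-8)]
  have "x * y = (a * b) / (s * t)" by (simp add: *)
  then show ?thesis
    unfolding L_integers_def using d algint_mult * by blast
qed

lemma L_integers_of_nat [simp]: "of_nat n \<in> L_integers L"
  and L_integers_0 [simp]: "0 \<in> L_integers L"
  and L_integers_1 [simp]: "1 \<in> L_integers L"
  by (auto intro: L_integers_algint)

lemma L_integers_uminus: "x \<in> L_integers L \<Longrightarrow> - x \<in> L_integers L"
  using L_integers_mult[OF L_integers_algint[of "-1"], of x] by simp

lemma L_integers_diff: "x \<in> L_integers L \<Longrightarrow> y \<in> L_integers L \<Longrightarrow> x - y \<in> L_integers L"
  using L_integers_add[OF _ L_integers_uminus, of x y] by simp

lemma L_integers_power: "x \<in> L_integers L \<Longrightarrow> x ^ n \<in> L_integers L"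
  by (induction n) (auto intro: L_integers_mult)

lemma L_integers_sum: "(\<And>i. i \<in> I \<Longrightarrow> f i \<in> L_integers L) \<Longrightarrow> sum f I \<in> L_integers L"
  by (induction I rule: infinite_finite_induct) (auto intro: L_integers_add)

lemma L_maximal_subset: "x \<in> L_maximal L \<Longrightarrow> x \<in> L_integers L"
  unfolding L_maximal_def L_integers_def using place_subset by blast

lemma L_maximal_place: "x \<in> L \<Longrightarrow> x \<in> L_maximal L"
  unfolding L_maximal_def using one_notin_place by (force intro: exI[of _ 1])

lemma L_maximal_0 [simp]: "0 \<in> L_maximal L"
  by (intro L_maximal_place place_zero)

lemma L_maximal_add:
  assumes "x \<in> L_maximal L" "y \<in> L_maximal L"
  shows "x + y \<in> L_maximal L"
proof -
  obtain a s b t where *: "x = a / s" "y = b / t" "a \<in> L" "b \<in> L"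
      "algebraic_int s" "s \<notin> L" "algebraic_int t" "t \<notin> L"
    using assms unfolding L_maximal_def by blast
  note d = common_denominator[OF *(5-8)]
  have "x + y = (a * t + b * s) / (s * t)"
    using d by (simp add: * field_simps)
  moreover have "a * t + b * s \<in> L"
    using * by (intro place_add place_mult)
  ultimately show ?thesis
    unfolding L_maximal_def using d by blast
qed

lemma L_maximal_mult:
  assumes "x \<in> L_maximal L" "y \<in> L_integers L"
  shows "x * y \<in> L_maximal L"
proof -
  obtain a s b t where *: "x = a / s" "y = b / t" "a \<in> L" "algebraic_int b"
      "algebraic_int s" "s \<notin> L" "algebraic_int t" "t \<notin> L"
    using assms unfolding L_maximal_def L_integers_def by blast
  note d = common_denominator[OF *(5-8)]
  have "x * y = (a * b) / (s * t)" by (simp add: *)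
  then show ?thesis
    unfolding L_maximal_def using d place_mult * by blast
qed

lemma L_maximal_uminus: "x \<in> L_maximal L \<Longrightarrow> - x \<in> L_maximal L"
  using L_maximal_mult[OF _ L_integers_algint[of "-1"], of x] by simp

lemma L_maximal_diff: "x \<in> L_maximal L \<Longrightarrow> y \<in> L_maximal L \<Longrightarrow> x - y \<in> L_maximal L"
  using L_maximal_add[OF _ L_maximal_uminus, of x y] by simp

lemma L_cong_refl [simp]: "L_cong L x x"
  by (simp add: L_cong_def)

lemma L_cong_sym: "L_cong L x y \<Longrightarrow> L_cong L y x"
  unfolding L_cong_def using L_maximal_uminus by fastforce

lemma L_cong_trans [trans]: "L_cong L x y \<Longrightarrow> L_cong L y z \<Longrightarrow> L_cong L x z"
  unfolding L_cong_def using L_maximal_add by fastforce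

lemma L_cong_add: "L_cong L x y \<Longrightarrow> L_cong L x' y' \<Longrightarrow> L_cong L (x + x') (y + y')"
  unfolding L_cong_def using L_maximal_add[of "x - y" "x' - y'"] by (simp add: algebra_simps)

lemma L_cong_diff: "L_cong L x y \<Longrightarrow> L_cong L x' y' \<Longrightarrow> L_cong L (x - x') (y - y')"
  unfolding L_cong_def using L_maximal_diff[of "x - y" "x' - y'"] by (simp add: algebra_simps)

lemma L_cong_sum: "(\<And>i. i \<in> I \<Longrightarrow> L_cong L (f i) (g i)) \<Longrightarrow> L_cong L (sum f I) (sum g I)"
  by (induction I rule: infinite_finite_induct) (auto intro: L_cong_add)

lemma L_cong_scale: "L_cong L x y \<Longrightarrow> c \<in> L_integers L \<Longrightarrow> L_cong L (c * x) (c * y)"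
  unfolding L_cong_def using L_maximal_mult[of "x - y" c] by (simp add: algebra_simps)

lemma reduction_def': "reduction L x = (\<lambda>m. m + x) ` L_maximal L"
  by (auto simp: reduction_def a_r_coset_def r_coset_def L_ring_def)

text \<open>
  Two cosets of an additive group are equal exactly when the difference of their representatives
  lies in the group.  This holds for non-integral representatives as well, which matters because
  the coefficients of \<open>T\<^sub>p g\<close> in weight zero contain the factor \<open>p\<^sup>-\<^sup>1\<close>.
\<close>

lemma reduction_eq_iff: "reduction L x = reduction L y \<longleftrightarrow> L_cong L x y"
proof
  assume "reduction L x = reduction L y"
  moreover have "x \<in> reduction L x"
    unfolding reduction_def' by (rule image_eqI[of _ _ 0]) auto
  ultimately show "L_cong L x y"
    by (auto simp: reduction_def' L_cong_def)
next
  have *: "reduction L x \<subseteq> reduction L y" if "L_cong L x y" for x y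
  proof
    fix w assume "w \<in> reduction L x"
    then obtain m where "m \<in> L_maximal L" "w = m + x"
      by (auto simp: reduction_def')
    then show "w \<in> reduction L y"
      using that unfolding reduction_def' L_cong_def
      by (intro image_eqI[of _ _ "m + (x - y)"]) (auto intro: L_maximal_add)
  qed
  assume "L_cong L x y"
  with *[OF this] *[OF L_cong_sym[OF this]] show "reduction L x = reduction L y" by blast
qed

lemma carrier_residue_field: "carrier (residue_field L) = reduction L ` L_integers L"
  by (auto simp: residue_field_def FactRing_def A_RCOSETS_def' reduction_def L_ring_def)

lemma reduction_mult:
  assumes "x \<in> L_integers L" "y \<in> L_integers L"
  shows "reduction L x \<otimes>\<^bsub>residue_field L\<^esub> reduction L y = reduction L (x * y)"
proof -
  have "reduction L x \<otimes>\<^bsub>residue_field L\<^esub> reduction L y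
          = (\<Union>a\<in>reduction L x. \<Union>b\<in>reduction L y. reduction L (a * b))"
    by (simp add: residue_field_def FactRing_def rcoset_mult_def reduction_def L_ring_def)
  also have "\<dots> = (\<Union>a\<in>reduction L x. \<Union>b\<in>reduction L y. reduction L (x * y))"
  proof (intro SUP_cong refl)
    fix a b assume "a \<in> reduction L x" "b \<in> reduction L y"
    then have ab: "L_cong L a x" "L_cong L b y"
      by (auto simp: reduction_def' L_cong_def)
    have b: "b \<in> L_integers L"
      using L_integers_add[OF L_maximal_subset[OF ab(2)[unfolded L_cong_def]] assms(2)] by simp
    have "L_cong L (a * b) (x * b)"
      using L_cong_scale[OF ab(1) b] by (simp add: mult.commute)
    also have "L_cong L (x * b) (x * y)"
      by (rule L_cong_scale[OF ab(2) assms(1)])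
    finally show "reduction L (a * b) = reduction L (x * y)"
      by (simp add: reduction_eq_iff)
  qed
  also have "\<dots> = reduction L (x * y)"
    using L_maximal_0 by (auto simp: reduction_def')
  finally show ?thesis .
qed

end

section \<open>Values of Dirichlet characters\<close>

lemma dirichlet_char_cong:
  assumes "dirichlet_char N \<psi>" and "[m = n] (mod int N)"
  shows "\<psi> m = \<psi> n"
proof -
  have *: "\<psi> (n + int N * int k) = \<psi> n" for n k
  proof (induction k)
    case (Suc k)
    have "\<psi> (n + int N * int (Suc k)) = \<psi> ((n + int N * int k) + int N)"
      by (simp add: algebra_simps)
    also have "\<dots> = \<psi> n"
      using assms(1) Suc unfolding dirichlet_char_def by simp
    finally show ?case .
  qed simp
  obtain k where k: "n = m + int N * k"
    using assms(2) cong_iff_lin by blast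
  show ?thesis
  proof (cases "k \<ge> 0")
    case True
    with k *[of m "nat k"] show ?thesis by simp
  next
    case False
    with k *[of n "nat (- k)"] show ?thesis by simp
  qed
qed

lemma dirichlet_char_one: "dirichlet_char N \<psi> \<Longrightarrow> \<psi> 1 = 1"
proof -
  assume *: "dirichlet_char N \<psi>"
  then have "\<psi> (1 * 1) = \<psi> 1 * \<psi> 1" "\<psi> 1 \<noteq> 0"
    unfolding dirichlet_char_def by (blast, simp)
  then show ?thesis by simp
qed

lemma dirichlet_char_power: "dirichlet_char N \<psi> \<Longrightarrow> \<psi> (n ^ k) = \<psi> n ^ k"
  by (induction k) (simp_all add: dirichlet_char_one, simp add: dirichlet_char_def)

text \<open>Nonzero values are roots of unity, by Euler's theorem.\<close>

lemma algebraic_int_dirichlet_char: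
  assumes "dirichlet_char N \<psi>" "N > 0"
  shows "algebraic_int (\<psi> n)"
proof (cases "coprime n (int N)")
  case False
  then have "\<psi> n = 0" using assms unfolding dirichlet_char_def by simp
  then show ?thesis by simp
next
  case True
  define m where "m = nat (n mod int N)"
  have m: "int m = n mod int N" using assms(2) by (simp add: m_def)
  have "coprime (int m) (int N)"
    using True m by (metis coprime_mod_left_iff less_numeral_extra(3) assms(2) of_nat_0_eq_iff)
  then have "[m ^ totient N = 1] (mod N)"
    by (intro euler_theorem) simp
  then have 1: "[int m ^ totient N = 1] (mod int N)"
    by (metis cong_int_iff of_nat_1 of_nat_power)
  have "\<psi> n ^ totient N = \<psi> (int m) ^ totient N"
    by (metis dirichlet_char_cong[OF assms(1)] m cong_mod_left cong_refl)
  also have "\<dots> = \<psi> (int m ^ totient N)"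
    by (simp add: dirichlet_char_power[OF assms(1)])
  also have "\<dots> = 1"
    using dirichlet_char_cong[OF assms(1) 1] dirichlet_char_one[OF assms(1)] by simp
  finally have *: "\<psi> n ^ totient N = 1" .
  show ?thesis
    by (rule algebraic_int_root[where p = "Polynomial.monom 1 (totient N)" and y = 1])
       (use * assms(2) in \<open>auto simp: poly_monom degree_monom_eq\<close>)
qed

section \<open>Fourier expansions\<close>

abbreviation nome :: "complex \<Rightarrow> complex" where
  "nome z \<equiv> exp (2 * of_real pi * \<i> * z)"

definition has_q_expansion :: "(complex \<Rightarrow> complex) \<Rightarrow> (nat \<Rightarrow> complex) \<Rightarrow> bool" where
  "has_q_expansion f a \<longleftrightarrow> (\<forall>z\<in>upper_half. (\<lambda>n. a n * nome z ^ n) sums f z)"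

lemma open_upper_half [simp]: "open upper_half"
  by (simp add: upper_half_def open_halfspace_Im_gt)

lemma norm_nome: "norm (nome z) = exp (- 2 * pi * Im z)"
  by (simp add: norm_exp_eq_Re)

lemma norm_nome_less_1_iff: "norm (nome z) < 1 \<longleftrightarrow> z \<in> upper_half"
  by (simp add: norm_nome upper_half_def zero_less_mult_iff)

lemma norm_nome_less_1: "z \<in> upper_half \<Longrightarrow> norm (nome z) < 1"
  by (simp only: norm_nome_less_1_iff)

lemma nome_Ln: "w \<noteq> 0 \<Longrightarrow> nome (Ln w / (2 * of_real pi * \<i>)) = w"
  by simp

lemma obtain_nome:
  assumes "w \<noteq> 0" "norm w < 1"
  obtains z where "z \<in> upper_half" "nome z = w"
  using nome_Ln[OF assms(1)] norm_nome_less_1_iff assms(2) by metis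

lemma q_expansion_summable:
  assumes "has_q_expansion f a" "norm w < 1"
  shows "summable (\<lambda>n. norm (a n * w ^ n))"
proof -
  obtain r where r: "norm w < r" "r < 1"
    using dense assms(2) by blast
  then have "complex_of_real r \<noteq> 0" "norm (complex_of_real r) < 1"
    using norm_ge_zero[of w] by (auto simp del: norm_ge_zero)
  then obtain z where z: "z \<in> upper_half" "nome z = of_real r"
    by (rule obtain_nome)
  have "summable (\<lambda>n. a n * of_real r ^ n)"
    using assms(1) z sums_summable unfolding has_q_expansion_def by metis
  then show ?thesis
    using r by (intro powser_insidea) auto
qed

text \<open>
  The nomes fill the punctured unit disc; the missing value at the origin is recovered by
  continuity before the coefficients are read off.
\<close>

lemma q_expansion_unique:
  assumes a: "has_q_expansion f a" and b: "has_q_expansion f b"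
  shows "a = b"
proof -
  have radius: "fps_conv_radius (Abs_fps c) \<ge> 1" if "has_q_expansion f c" for c
    unfolding fps_conv_radius_def
  proof (rule conv_radius_geI_ex)
    fix r :: real assume "0 < r" "ereal r < 1"
    then show "\<exists>z. norm z = r \<and> summable (\<lambda>n. fps_nth (Abs_fps c) n * z ^ n)"
      using q_expansion_summable[OF that, of "of_real r"]
      by (intro exI[of _ "of_real r"]) (auto dest: summable_norm_cancel simp: one_ereal_def)
  qed
  have radius': "ball 0 1 \<subseteq> eball 0 (fps_conv_radius (Abs_fps c))" if "has_q_expansion f c" for c
    using radius[OF that] by (auto simp: eball_def one_ereal_def intro: less_le_trans[of _ "ereal 1"])
  have eq: "eval_fps (Abs_fps a) w = eval_fps (Abs_fps b) w" if w: "w \<in> ball 0 1 - {0}" for w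
  proof -
    obtain z where "z \<in> upper_half" "nome z = w"
      using w by (elim DiffE) (rule obtain_nome[of w], auto)
    then show ?thesis
      using a b by (auto simp: eval_fps_def has_q_expansion_def sums_iff)
  qed
  define d where "d = (\<lambda>w. eval_fps (Abs_fps a) w - eval_fps (Abs_fps b) w)"
  have d: "d w = 0" if "w \<in> ball 0 1 - {0}" for w
    using eq[OF that] by (simp add: d_def)
  have "continuous_on (ball 0 1) d"
    unfolding d_def using radius' a b
    by (intro continuous_intros continuous_on_eval_fps') auto
  then have "d \<midarrow>0\<rightarrow> d 0"
    by (simp add: continuous_on_eq_continuous_at isCont_def)
  moreover have "d \<midarrow>0\<rightarrow> 0"
    using eventually_at_in_open[of "ball 0 1" 0, THEN eventually_mono, of "\<lambda>w. d w = 0"] d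
    by (intro tendsto_eventually) auto
  ultimately have "d 0 = 0"
    by (rule LIM_unique)
  with d have "d w = 0" if "w \<in> ball 0 1" for w
    using that by (cases "w = 0") auto
  then have ev: "eventually (\<lambda>w. eval_fps (Abs_fps a) w = eval_fps (Abs_fps b) w) (nhds 0)"
    using eventually_nhds_in_open[of "ball 0 1" "0 :: complex"]
    by (auto simp: d_def elim!: eventually_mono)
  have "Abs_fps a = Abs_fps b"
    by (rule eval_fps_eqD[OF _ _ ev]) (use radius a b in \<open>auto intro: less_le_trans[of _ 1]\<close>)
  then show ?thesis by (simp add: fps_eq_iff fun_eq_iff)
qed

lemma qcoeff_eq: "has_q_expansion f a \<Longrightarrow> qcoeff f = a"
  unfolding qcoeff_def has_q_expansion_def[symmetric]
  by (rule the_equality) (auto intro: q_expansion_unique)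

lemma has_q_expansion_one: "has_q_expansion (\<lambda>_. 1) (\<lambda>n. if n = 0 then 1 else 0)"
  unfolding has_q_expansion_def
proof
  fix z
  show "(\<lambda>n. (if n = 0 then 1 else 0) * nome z ^ n) sums 1"
    using sums_finite[of "{0}" "\<lambda>n. (if n = 0 then 1 else 0) * nome z ^ n"] by simp
qed

lemma has_q_expansion_zero: "has_q_expansion (\<lambda>_. 0) (\<lambda>_. 0)"
  by (simp add: has_q_expansion_def)

lemma has_q_expansion_scale:
  "has_q_expansion f a \<Longrightarrow> has_q_expansion (\<lambda>z. c * f z) (\<lambda>n. c * a n)"
  unfolding has_q_expansion_def by (auto simp: mult.assoc intro: sums_mult)

lemma has_q_expansion_diff:
  "has_q_expansion f a \<Longrightarrow> has_q_expansion g b \<Longrightarrow>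
     has_q_expansion (\<lambda>z. f z - g z) (\<lambda>n. a n - b n)"
  unfolding has_q_expansion_def by (auto simp: left_diff_distrib intro: sums_diff)

lemma has_q_expansion_mult:
  assumes a: "has_q_expansion f a" and b: "has_q_expansion g b"
  shows "has_q_expansion (\<lambda>z. f z * g z) (\<lambda>n. \<Sum>i\<le>n. a i * b (n - i))"
  unfolding has_q_expansion_def
proof
  fix z assume z: "z \<in> upper_half"
  let ?q = "nome z"
  have "(\<lambda>n. \<Sum>i\<le>n. (a i * ?q ^ i) * (b (n - i) * ?q ^ (n - i)))
          sums ((\<Sum>n. a n * ?q ^ n) * (\<Sum>n. b n * ?q ^ n))"
    using q_expansion_summable[OF a] q_expansion_summable[OF b] norm_nome_less_1[OF z]
    by (intro Cauchy_product_sums)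
  also have "(\<lambda>n. \<Sum>i\<le>n. (a i * ?q ^ i) * (b (n - i) * ?q ^ (n - i)))
               = (\<lambda>n. (\<Sum>i\<le>n. a i * b (n - i)) * ?q ^ n)"
  proof
    fix n
    have "(a i * ?q ^ i) * (b (n - i) * ?q ^ (n - i)) = a i * b (n - i) * ?q ^ n"
      if "i \<le> n" for i
    proof -
      have "?q ^ n = ?q ^ i * ?q ^ (n - i)"
        using that by (simp flip: power_add)
      then show ?thesis by (simp only: mult_ac)
    qed
    then show "(\<Sum>i\<le>n. (a i * ?q ^ i) * (b (n - i) * ?q ^ (n - i)))
                 = (\<Sum>i\<le>n. a i * b (n - i)) * ?q ^ n"
      by (auto simp only: sum_distrib_right atMost_iff intro!: sum.cong)
  qed
  also have "(\<Sum>n. a n * ?q ^ n) * (\<Sum>n. b n * ?q ^ n) = f z * g z"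
    using a b z by (simp add: has_q_expansion_def sums_iff)
  finally show "(\<lambda>n. (\<Sum>i\<le>n. a i * b (n - i)) * ?q ^ n) sums (f z * g z)" .
qed

lemma has_q_expansion_theta:
  assumes a: "has_q_expansion f a"
  shows "has_q_expansion (theta f) (\<lambda>n. of_nat n * a n)"
  unfolding has_q_expansion_def
proof
  fix z assume z: "z \<in> upper_half"
  define P where "P = (\<lambda>w. \<Sum>n. a n * w ^ n)"
  have sums: "(\<lambda>n. a n * w ^ n) sums P w" if "norm w < 1" for w
    unfolding P_def by (intro summable_sums summable_norm_cancel[OF q_expansion_summable[OF a that]])
  let ?q = "nome z"
  have q: "norm ?q < 1" using z by (rule norm_nome_less_1)
  have "P holomorphic_on ball 0 1"
    by (rule power_series_holomorphic[where a = a]) (use sums in auto)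
  then have DP: "(P has_field_derivative deriv P ?q) (at ?q)"
    using q by (intro holomorphic_derivI) auto
  have DPq: "((\<lambda>z. P (nome z)) has_field_derivative (deriv P ?q * (?q * (2 * of_real pi * \<i>)))) (at z)"
    by (rule DERIV_chain2[where f = P and g = nome, OF DP]) (auto intro!: derivative_eq_intros)
  have Pq: "P (nome u) = f u" if "u \<in> upper_half" for u
    using a that unfolding P_def has_q_expansion_def by (simp add: sums_iff)
  have "(f has_field_derivative (deriv P ?q * (?q * (2 * of_real pi * \<i>)))) (at z)"
    by (rule has_field_derivative_transform_within_open[OF DPq open_upper_half z Pq])
  then have "theta f z = ?q * deriv P ?q"
    using z by (simp add: theta_def DERIV_imp_deriv field_simps)
  moreover have "(\<lambda>n. ?q * (diffs a n * ?q ^ n)) sums (?q * deriv P ?q)"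
    by (intro sums_mult termdiffs_sums_strong[OF _ DP q]) (use sums in auto)
  then have "(\<lambda>n. of_nat (Suc n) * a (Suc n) * ?q ^ Suc n) sums (?q * deriv P ?q)"
    by (simp add: diffs_def mult_ac)
  then have "(\<lambda>n. of_nat n * a n * ?q ^ n) sums (?q * deriv P ?q)"
    by (subst (asm) sums_Suc_iff) simp
  ultimately show "(\<lambda>n. of_nat n * a n * ?q ^ n) sums theta f z" by simp
qed

lemma has_q_expansion_hecke:
  assumes a: "has_q_expansion f a" and "p > 0"
  shows "has_q_expansion (hecke k \<epsilon> p f)
           (\<lambda>n. a (n * p) + of_nat p powi (int k - 1) * \<epsilon> (int p) * (if p dvd n then a (n div p) else 0))"
    (is "has_q_expansion _ ?b")
  unfolding has_q_expansion_def
proof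
  fix z assume z: "z \<in> upper_half"
  let ?q = "nome z"
  have up: "strict_mono (\<lambda>n. n * p)"
    using assms(2) by (auto simp: strict_mono_def)
  \<comment> \<open>A \<open>p\<close>-th root of the nome again lies in the disc of convergence.\<close>
  define r where "r = nome (z / of_nat p)"
  have r: "norm r < 1"
    unfolding r_def using z assms(2) by (intro norm_nome_less_1) (simp add: upper_half_def)
  have rp: "r ^ p = ?q"
    using assms(2) by (simp add: r_def flip: exp_of_nat_mult)
  have "summable ((\<lambda>n. norm (a n * r ^ n)) \<circ> (\<lambda>n. n * p))"
    using strict_mono_imp_inj_on[OF up] by (intro summable_reindex q_expansion_summable[OF a r]) auto
  moreover have "r ^ (n * p) = ?q ^ n" for n
    by (simp only: rp[symmetric] mult.commute[of n] power_mult)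
  ultimately have "summable (\<lambda>n. norm (a (n * p) * ?q ^ n))"
    by (simp only: o_def)
  then have U: "summable (\<lambda>n. a (n * p) * ?q ^ n)"
    by (rule summable_norm_cancel)
  have "norm (?q ^ p) < 1"
    using norm_nome_less_1[OF z] assms(2) by (simp add: norm_power power_less_one_iff)
  from summable_norm_cancel[OF q_expansion_summable[OF a this]]
  have "summable (\<lambda>n. a n * ?q ^ (n * p))"
    by (simp only: mult.commute[of _ p] power_mult)
  then have "summable (\<lambda>n. (if p dvd n * p then a (n * p div p) else 0) * ?q ^ (n * p))"
    using assms(2) by simp
  moreover have "(if p dvd n then a (n div p) else 0) * ?q ^ n = 0" if "n \<notin> range (\<lambda>n. n * p)" for n
    using that by (auto elim!: dvdE)
  ultimately have V: "summable (\<lambda>n. (if p dvd n then a (n div p) else 0) * ?q ^ n)"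
    using summable_mono_reindex[OF up, of "\<lambda>n. (if p dvd n then a (n div p) else 0) * ?q ^ n"]
    by blast
  have "summable (\<lambda>n. ?b n * ?q ^ n)"
    using summable_add[OF U summable_mult[OF V, of "of_nat p powi (int k - 1) * \<epsilon> (int p)"]]
    by (simp only: distrib_right mult.assoc)
  then show "(\<lambda>n. ?b n * ?q ^ n) sums hecke k \<epsilon> p f z"
    using z summable_sums unfolding hecke_def qcoeff_eq[OF a] by simp
qed

text \<open>
  As a function of the nome, \<open>f\<close> is holomorphic on the punctured disc and bounded near the
  origin, so the origin is a removable singularity and the Fourier expansion is a Taylor expansion.
\<close>

lemma has_q_expansion_periodic:
  assumes hol: "f holomorphic_on upper_half"
    and per: "\<And>z. z \<in> upper_half \<Longrightarrow> f (z + 1) = f z"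
    and bdd: "bounded (f ` {z. Im z > Y})"
  shows "\<exists>a. has_q_expansion f a"
proof -
  have per_nat: "f (z + of_nat n) = f z" if "z \<in> upper_half" for z n
    using that
  proof (induction n)
    case (Suc n)
    then show ?case using per[of "z + of_nat n"] by (simp add: upper_half_def add_ac)
  qed simp
  have per_int: "f (z + of_int n) = f z" if "z \<in> upper_half" for z n
  proof (cases "n \<ge> 0")
    case True
    then show ?thesis using per_nat[OF that, of "nat n"] by simp
  next
    case False
    then show ?thesis using per_nat[of "z + of_int n" "nat (- n)"] that by (simp add: upper_half_def)
  qed
  have inv: "f z = f u" if "z \<in> upper_half" "nome z = nome u" for z u
  proof -
    obtain n :: int where "2 * of_real pi * \<i> * z = 2 * of_real pi * \<i> * u + of_int (2 * n) * pi * \<i>"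
      using \<open>nome z = nome u\<close> unfolding exp_eq by blast
    then have "2 * of_real pi * \<i> * z = 2 * of_real pi * \<i> * (u + of_int n)"
      by (simp add: algebra_simps)
    then have n: "z = u + of_int n" by simp
    then show ?thesis using per_int[of u n] that by (simp add: upper_half_def)
  qed
  define G where "G = (\<lambda>w. f (Ln w / (2 * of_real pi * \<i>)))"
  have G_nome: "G (nome z) = f z" if "z \<in> upper_half" for z
    unfolding G_def using inv[OF that, of "Ln (nome z) / (2 * of_real pi * \<i>)"] nome_Ln[of "nome z"]
    by simp
  have "G holomorphic_on ball 0 1 - {0}"
    unfolding holomorphic_on_def
  proof
    fix w0 :: complex assume w0: "w0 \<in> ball 0 1 - {0}"
    obtain z0 where z0: "z0 \<in> upper_half" "nome z0 = w0"
      using w0 by (elim DiffE) (rule obtain_nome[of w0], auto)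
    \<comment> \<open>The branch of the logarithm centred at \<open>w0\<close>, which avoids the cut of the principal one.\<close>
    define u where "u = (\<lambda>w. z0 + Ln (w / w0) / (2 * of_real pi * \<i>))"
    have nome_u: "nome (u w) = w" if "w \<noteq> 0" for w
    proof -
      have "nome (u w) = nome z0 * nome (Ln (w / w0) / (2 * of_real pi * \<i>))"
        unfolding u_def by (simp add: distrib_left exp_add)
      also have "\<dots> = w"
        using that w0 z0(2) by (subst nome_Ln) auto
      finally show ?thesis .
    qed
    have "\<exists>D. (u has_field_derivative D) (at w0)"
      unfolding u_def using w0 by (intro exI derivative_eq_intros | simp)+
    then obtain D where D: "(u has_field_derivative D) (at w0)" ..
    have "u w0 = z0" using w0 by (simp add: u_def)
    then have "(f has_field_derivative deriv f z0) (at (u w0))"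
      using holomorphic_derivI[OF hol open_upper_half z0(1)] by simp
    from DERIV_chain2[OF this D]
    have Dfu: "((\<lambda>w. f (u w)) has_field_derivative deriv f z0 * D) (at w0)" .
    have fu: "f (u w) = G w" if "w \<in> ball 0 1 - {0}" for w
    proof -
      have "u w \<in> upper_half"
        using nome_u[of w] that norm_nome_less_1_iff[of "u w"] by simp
      then show ?thesis using G_nome[of "u w"] nome_u[of w] that by simp
    qed
    have "(G has_field_derivative deriv f z0 * D) (at w0)"
      by (rule has_field_derivative_transform_within_open[OF Dfu _ w0 fu]) (rule open_delete[OF open_ball])
    then show "G field_differentiable at w0 within ball 0 1 - {0}"
      using field_differentiable_at_within field_differentiable_def by blast
  qed
  moreover have "G \<in> O[at 0](\<lambda>_. 1)"
  proof -
    obtain B where B: "\<And>z. Im z > Y \<Longrightarrow> norm (f z) \<le> B"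
      using bdd unfolding bounded_iff by auto
    define r where "r = min 1 (exp (- 2 * pi * Y))"
    have "eventually (\<lambda>w. w \<in> ball 0 r - {0}) (at 0)"
      by (intro eventually_at_in_open) (auto simp: r_def)
    then have "eventually (\<lambda>w. norm (G w) \<le> B * norm (1 :: complex)) (at 0)"
    proof eventually_elim
      case (elim w)
      then obtain z where z: "z \<in> upper_half" "nome z = w"
        by (elim DiffE) (rule obtain_nome[of w], auto simp: r_def)
      have "exp (- 2 * pi * Im z) < exp (- 2 * pi * Y)"
        using elim z(2) norm_nome[of z] by (simp add: r_def)
      then have "Im z > Y" by simp
      then show ?case using B G_nome[OF z(1)] z(2) by simp
    qed
    then show ?thesis
      by (intro landau_o.bigI[of "max B 1"]) (auto elim!: eventually_mono)
  qed
  ultimately obtain H where H: "H holomorphic_on ball 0 1" "\<forall>w\<in>ball 0 1 - {0}. H w = G w"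
    using holomorphic_on_extend[of G "ball 0 1" 0] by auto
  have "has_q_expansion f (\<lambda>n. (deriv ^^ n) H 0 / fact n)"
    unfolding has_q_expansion_def
  proof
    fix z assume z: "z \<in> upper_half"
    then have q: "nome z \<in> ball 0 1 - {0}"
      using norm_nome_less_1[of z] by simp
    then have "(\<lambda>n. (deriv ^^ n) H 0 / fact n * (nome z - 0) ^ n) sums H (nome z)"
      using H(1) by (intro holomorphic_power_series[where r = 1]) auto
    then show "(\<lambda>n. (deriv ^^ n) H 0 / fact n * nome z ^ n) sums f z"
      using H(2) q G_nome[OF z] by simp
  qed
  then show ?thesis by blast
qed

section \<open>The action of the modular group on brackets\<close>

lemma automorphy_factor_nonzero:
  assumes "a * d - b * c = (1 :: int)" "z \<in> upper_half"
  shows "of_int c * z + of_int d \<noteq> (0 :: complex)"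
proof
  assume *: "of_int c * z + of_int d = 0"
  then have "Im (of_int c * z + of_int d) = 0" by simp
  then have "of_int c * Im z = 0" by simp
  then have "c = 0" using assms(2) by (simp add: upper_half_def)
  with * assms(1) show False by simp
qed

lemma mobius_in_upper_half:
  assumes "a * d - b * c = 1" "z \<in> upper_half"
  shows "mobius a b c d z \<in> upper_half"
proof -
  let ?j = "of_int c * z + of_int d"
  have "Im (mobius a b c d z) = of_int (a * d - b * c) * Im z / ((Re ?j)\<^sup>2 + (Im ?j)\<^sup>2)"
    unfolding mobius_def Im_divide by (simp add: algebra_simps)
  also have "\<dots> > 0"
    using automorphy_factor_nonzero[OF assms] assms
    by (simp add: upper_half_def complex_eq_iff sum_power2_gt_zero_iff)
  finally show ?thesis by (simp add: upper_half_def)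
qed

lemma has_field_derivative_mobius:
  assumes "a * d - b * c = 1" "z \<in> upper_half"
  shows "(mobius a b c d has_field_derivative 1 / (of_int c * z + of_int d)\<^sup>2) (at z)"
proof -
  have det: "of_int a * of_int d - of_int b * of_int c = (1 :: complex)"
    using assms(1) by (metis of_int_1 of_int_diff of_int_mult)
  show ?thesis
    unfolding mobius_def [abs_def]
    using automorphy_factor_nonzero[OF assms] det
    by (auto intro!: derivative_eq_intros simp: power2_eq_square algebra_simps)
qed

lemma has_field_derivative_slash:
  assumes "f holomorphic_on upper_half" "a * d - b * c = 1" "z \<in> upper_half"
  shows "(slash k a b c d f has_field_derivative
           (deriv f (mobius a b c d z) / (of_int c * z + of_int d) ^ (k + 2)
            - of_nat k * of_int c * f (mobius a b c d z) / (of_int c * z + of_int d) ^ (k + 1))) (at z)"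
proof -
  define j where "j = (\<lambda>z. of_int c * z + of_int d :: complex)"
  have j: "j z \<noteq> 0" unfolding j_def by (rule automorphy_factor_nonzero[OF assms(2,3)])
  have dj: "((\<lambda>z. j z ^ k) has_field_derivative of_nat k * j z ^ (k - 1) * of_int c) (at z)"
    unfolding j_def by (auto intro!: derivative_eq_intros)
  have "((\<lambda>z. f (mobius a b c d z)) has_field_derivative deriv f (mobius a b c d z) * (1 / (j z)\<^sup>2)) (at z)"
    unfolding j_def
    by (rule DERIV_chain2[where f = f and g = "mobius a b c d"])
       (use assms in \<open>auto intro!: holomorphic_derivI[OF _ open_upper_half] mobius_in_upper_half has_field_derivative_mobius\<close>)
  from DERIV_divide[OF this dj]
  have "((\<lambda>z. f (mobius a b c d z) / j z ^ k) has_field_derivative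
          (deriv f (mobius a b c d z) * (1 / (j z)\<^sup>2) * j z ^ k
            - f (mobius a b c d z) * (of_nat k * j z ^ (k - 1) * of_int c)) / (j z ^ k * j z ^ k)) (at z)"
    using j by simp
  also have "(deriv f (mobius a b c d z) * (1 / (j z)\<^sup>2) * j z ^ k
            - f (mobius a b c d z) * (of_nat k * j z ^ (k - 1) * of_int c)) / (j z ^ k * j z ^ k)
       = deriv f (mobius a b c d z) / j z ^ (k + 2)
            - of_nat k * of_int c * f (mobius a b c d z) / j z ^ (k + 1)"
    using j by (cases k) (simp_all add: field_simps power2_eq_square)
  finally show ?thesis
    by (simp add: slash_def [abs_def] j_def)
qed

lemma holomorphic_slash:
  assumes "f holomorphic_on upper_half" "a * d - b * c = 1"
  shows "slash k a b c d f holomorphic_on upper_half"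
  using has_field_derivative_slash[OF assms] by (subst holomorphic_on_open) auto

lemma holomorphic_theta: "f holomorphic_on upper_half \<Longrightarrow> theta f holomorphic_on upper_half"
  by (rule holomorphic_transform[where f = "\<lambda>z. deriv f z / (2 * \<i> * of_real pi)"])
     (auto intro!: holomorphic_intros simp: theta_def)

lemma theta_cong:
  assumes "\<And>u. u \<in> upper_half \<Longrightarrow> f u = g u"
  shows "theta f z = theta g z"
proof (cases "z \<in> upper_half")
  case True
  have "eventually (\<lambda>u. f u = g u) (nhds z)"
    using eventually_nhds_in_open[OF open_upper_half True] assms by (rule eventually_mono)
  with True show ?thesis by (simp add: theta_def deriv_cong_ev)
qed (simp add: theta_def)

lemma theta_scale: "f holomorphic_on upper_half \<Longrightarrow> theta (\<lambda>z. c * f z) z = c * theta f z"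
  unfolding theta_def
  by (auto simp: holomorphic_on_imp_differentiable_at[OF _ open_upper_half])

lemma theta_add:
  "f holomorphic_on upper_half \<Longrightarrow> g holomorphic_on upper_half \<Longrightarrow>
     theta (\<lambda>z. f z + g z) z = theta f z + theta g z"
  unfolding theta_def
  by (auto simp: holomorphic_on_imp_differentiable_at[OF _ open_upper_half] add_divide_distrib)

lemma theta_zero [simp]: "theta (\<lambda>_. 0) z = 0"
  by (simp add: theta_def)

lemma bracket_cong:
  assumes "\<And>u. u \<in> upper_half \<Longrightarrow> f u = f' u" "\<And>u. u \<in> upper_half \<Longrightarrow> g u = g' u" "z \<in> upper_half"
  shows "homogeneous_bracket k f m g z = homogeneous_bracket k f' m g' z"
  unfolding homogeneous_bracket_def
  using assms theta_cong[of f f' z] theta_cong[of g g' z] by simp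

lemma bracket_scale_left:
  "f holomorphic_on upper_half \<Longrightarrow>
     homogeneous_bracket k (\<lambda>z. c * f z) m g z = c * homogeneous_bracket k f m g z"
  by (simp add: homogeneous_bracket_def theta_scale algebra_simps)

lemma bracket_scale_right:
  "g holomorphic_on upper_half \<Longrightarrow>
     homogeneous_bracket k f m (\<lambda>z. c * g z) z = c * homogeneous_bracket k f m g z"
  by (simp add: homogeneous_bracket_def theta_scale algebra_simps)

lemma bracket_add_left:
  "f holomorphic_on upper_half \<Longrightarrow> f' holomorphic_on upper_half \<Longrightarrow>
     homogeneous_bracket k (\<lambda>z. f z + f' z) m g z
       = homogeneous_bracket k f m g z + homogeneous_bracket k f' m g z"
  by (simp add: homogeneous_bracket_def theta_add algebra_simps)

lemma bracket_zero [simp]: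
  "homogeneous_bracket k (\<lambda>_. 0) m g z = 0" "homogeneous_bracket k f m (\<lambda>_. 0) z = 0"
  by (simp_all add: homogeneous_bracket_def)

text \<open>
  Differentiating \<open>f\<bar>\<gamma>\<close> produces, besides \<open>(\<theta> f)\<bar>\<gamma>\<close>, an error term proportional to the weight
  times \<open>f\<close>; the weights in the bracket are chosen such that the two error terms cancel.
\<close>

lemma bracket_slash:
  assumes f: "f holomorphic_on upper_half" and g: "g holomorphic_on upper_half"
    and det: "a * d - b * c = 1" and z: "z \<in> upper_half"
  shows "homogeneous_bracket k (slash k a b c d f) m (slash m a b c d g) z
           = slash (k + m + 2) a b c d (homogeneous_bracket k f m g) z"
proof -
  define j where "j = of_int c * z + of_int d"
  define w where "w = mobius a b c d z"
  have j: "j \<noteq> 0" unfolding j_def by (rule automorphy_factor_nonzero[OF det z])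
  have w: "w \<in> upper_half" unfolding w_def by (rule mobius_in_upper_half[OF det z])
  have "deriv (slash n a b c d h) z = deriv h w / j ^ (n + 2) - of_nat n * of_int c * h w / j ^ (n + 1)"
    if "h holomorphic_on upper_half" for n h
    unfolding w_def j_def by (rule DERIV_imp_deriv[OF has_field_derivative_slash[OF that det z]])
  note D = this[OF f, of k] this[OF g, of m]
  have S: "slash n a b c d h z = h w / j ^ n" for n h
    by (simp add: slash_def w_def j_def)
  show ?thesis
    unfolding S homogeneous_bracket_def theta_def using z w j
    by (simp add: D field_simps power_add power2_eq_square)
qed

text \<open>
  Cauchy's estimate on discs of radius one bounds the derivative, at the cost of raising the
  half plane by one.
\<close>

lemma bounded_theta:
  assumes hol: "f holomorphic_on upper_half" and bdd: "bounded (f ` {z. Im z > Y})"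
  shows "bounded (theta f ` {z. Im z > max Y 0 + 1})"
proof -
  obtain B where B: "\<And>z. Im z > Y \<Longrightarrow> norm (f z) \<le> B"
    using bdd unfolding bounded_iff by auto
  have "norm (theta f z) \<le> B / (2 * pi)" if z: "Im z > max Y 0 + 1" for z
  proof -
    have Im: "Im u > max Y 0" if "u \<in> cball z 1" for u
    proof -
      have "\<bar>Im (z - u)\<bar> \<le> 1"
        using that abs_Im_le_cmod[of "z - u"] by (simp add: dist_norm)
      then show ?thesis using z by (auto simp: abs_le_iff)
    qed
    then have sub: "cball z 1 \<subseteq> upper_half"
      by (force simp: upper_half_def)
    have "norm ((deriv ^^ 1) f z) \<le> fact 1 * B / 1 ^ 1"
    proof (rule Cauchy_inequality)
      show "f holomorphic_on ball z 1"
        using hol sub ball_subset_cball by (meson holomorphic_on_subset)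
      show "continuous_on (cball z 1) f"
        using hol sub by (meson holomorphic_on_subset holomorphic_on_imp_continuous_on)
      fix u assume "norm (z - u) = 1"
      then have "u \<in> cball z 1" by (simp add: dist_norm)
      from Im[OF this] show "norm (f u) \<le> B" by (intro B) simp
    qed simp
    moreover have "z \<in> upper_half" using z by (simp add: upper_half_def)
    ultimately show ?thesis by (simp add: theta_def norm_divide norm_mult divide_right_mono)
  qed
  then show ?thesis unfolding bounded_iff by auto
qed

lemma bounded_bracket:
  assumes f: "f holomorphic_on upper_half" "bounded (f ` {z. Im z > Y})"
    and g: "g holomorphic_on upper_half" "bounded (g ` {z. Im z > Y'})"
  shows "\<exists>Z. bounded (homogeneous_bracket k f m g ` {z. Im z > Z})"
proof -
  define Z where "Z = max (max Y 0 + 1) (max Y' 0 + 1)"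
  have "bounded (f ` {z. Im z > Z})" "bounded (g ` {z. Im z > Z})"
       "bounded (theta f ` {z. Im z > Z})" "bounded (theta g ` {z. Im z > Z})"
    by (rule bounded_subset[OF f(2)] bounded_subset[OF g(2)]
          bounded_subset[OF bounded_theta[OF f]] bounded_subset[OF bounded_theta[OF g]];
        force simp: Z_def)+
  then obtain F G F' G' where
    "\<forall>w\<in>f ` {z. Im z > Z}. norm w \<le> F" "\<forall>w\<in>g ` {z. Im z > Z}. norm w \<le> G"
    "\<forall>w\<in>theta f ` {z. Im z > Z}. norm w \<le> F'" "\<forall>w\<in>theta g ` {z. Im z > Z}. norm w \<le> G'"
    unfolding bounded_iff by (elim exE)
  then have *: "norm (f z) \<le> F" "norm (g z) \<le> G" "norm (theta f z) \<le> F'" "norm (theta g z) \<le> G'"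
    if "Im z > Z" for z
    using that by auto
  have "norm (homogeneous_bracket k f m g z) \<le> of_nat k * F * G' + of_nat m * G * F'"
    if z: "Im z > Z" for z
  proof -
    have "norm (homogeneous_bracket k f m g z)
            \<le> of_nat k * norm (f z) * norm (theta g z) + of_nat m * norm (g z) * norm (theta f z)"
      unfolding homogeneous_bracket_def by (rule norm_triangle_le_diff) (simp add: norm_mult)
    also have "\<dots> \<le> of_nat k * F * G' + of_nat m * G * F'"
      using *[OF z] order_trans[OF norm_ge_zero *(1)[OF z]] order_trans[OF norm_ge_zero *(2)[OF z]]
      by (intro add_mono mult_mono) auto
    finally show ?thesis .
  qed
  then have "bounded (homogeneous_bracket k f m g ` {z. Im z > Z})"
    unfolding bounded_iff by auto
  then show ?thesis ..
qed

text \<open>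
  Since the bracket commutes with the action of the whole modular group, boundedness at every cusp
  reduces to boundedness at \<open>i\<infinity>\<close>.
\<close>

lemma holo_with_cusps_bracket:
  assumes f: "holo_with_cusps k f" and g: "holo_with_cusps m g"
  shows "holo_with_cusps (k + m + 2) (homogeneous_bracket k f m g)"
proof -
  have hol: "f holomorphic_on upper_half" "g holomorphic_on upper_half"
    using f g by (auto simp: holo_with_cusps_def)
  have "\<exists>Y. bounded (slash (k + m + 2) a b c d (homogeneous_bracket k f m g) ` {z. Im z > Y})"
    if det: "a * d - b * c = 1" for a b c d
  proof -
    obtain Y Y' where "bounded (slash k a b c d f ` {z. Im z > Y})" "bounded (slash m a b c d g ` {z. Im z > Y'})"
      using f g det unfolding holo_with_cusps_def by blast
    from bounded_bracket[OF holomorphic_slash[OF hol(1) det] this(1) holomorphic_slash[OF hol(2) det] this(2)]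
    obtain Z where Z: "bounded (homogeneous_bracket k (slash k a b c d f) m (slash m a b c d g) ` {z. Im z > Z})"
      by blast
    have "slash (k + m + 2) a b c d (homogeneous_bracket k f m g) ` {z. Im z > max Z 0}
            = homogeneous_bracket k (slash k a b c d f) m (slash m a b c d g) ` {z. Im z > max Z 0}"
      using bracket_slash[OF hol det] by (intro image_cong) (auto simp: upper_half_def)
    moreover have "bounded (homogeneous_bracket k (slash k a b c d f) m (slash m a b c d g) ` {z. Im z > max Z 0})"
      by (rule bounded_subset[OF Z]) auto
    ultimately show ?thesis by metis
  qed
  moreover have "homogeneous_bracket k f m g holomorphic_on upper_half"
    unfolding homogeneous_bracket_def [abs_def] using hol by (intro holomorphic_intros holomorphic_theta)
  moreover have "homogeneous_bracket k f m g z = 0" if "z \<notin> upper_half" for z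
    using that by (simp add: homogeneous_bracket_def theta_def)
  ultimately show ?thesis unfolding holo_with_cusps_def by blast
qed

lemma slash_bracket_eigen:
  assumes hol: "f holomorphic_on upper_half" "g holomorphic_on upper_half"
    and det: "a * d - b * c = 1"
    and "\<And>u. u \<in> upper_half \<Longrightarrow> slash k a b c d f u = \<alpha> * f u"
    and "\<And>u. u \<in> upper_half \<Longrightarrow> slash m a b c d g u = \<beta> * g u"
    and z: "z \<in> upper_half"
  shows "slash (k + m + 2) a b c d (homogeneous_bracket k f m g) z
           = \<alpha> * \<beta> * homogeneous_bracket k f m g z"
proof -
  have "slash (k + m + 2) a b c d (homogeneous_bracket k f m g) z
          = homogeneous_bracket k (\<lambda>z. \<alpha> * f z) m (\<lambda>z. \<beta> * g z) z"
    unfolding bracket_slash[OF hol det z, symmetric] using assms(4-6) by (rule bracket_cong)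
  also have "\<dots> = \<alpha> * \<beta> * homogeneous_bracket k f m g z"
    using hol by (simp add: bracket_scale_left bracket_scale_right)
  finally show ?thesis .
qed

lemma modforms_holomorphic: "f \<in> modforms k N \<Longrightarrow> f holomorphic_on upper_half"
  by (simp add: modforms_def holo_with_cusps_def)

lemma modforms_bounded_at_cusps:
  "f \<in> modforms k N \<Longrightarrow> a * d - b * c = 1 \<Longrightarrow> \<exists>Y. bounded (slash k a b c d f ` {z. Im z > Y})"
  by (simp add: modforms_def holo_with_cusps_def)

lemma bracket_modforms_char:
  assumes f: "f \<in> modforms_char k N \<epsilon>" and g: "g \<in> modforms_char m N \<psi>"
  shows "homogeneous_bracket k f m g \<in> modforms_char (k + m + 2) N (\<lambda>n. \<epsilon> n * \<psi> n)"
proof -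
  have h: "holo_with_cusps k f" "holo_with_cusps m g"
    using f g by (simp_all add: modforms_char_def)
  then have hol: "f holomorphic_on upper_half" "g holomorphic_on upper_half"
    by (simp_all add: holo_with_cusps_def)
  have "slash (k + m + 2) a b c d (homogeneous_bracket k f m g) z
          = \<epsilon> d * \<psi> d * homogeneous_bracket k f m g z"
    if "a * d - b * c = 1" "int N dvd c" "z \<in> upper_half" for a b c d z
    using that f g by (intro slash_bracket_eigen[OF hol]) (simp_all add: modforms_char_def)
  then show ?thesis
    unfolding modforms_char_def using holo_with_cusps_bracket[OF h] by blast
qed

lemma bracket_modforms:
  assumes f: "f \<in> modforms k N" and g: "g \<in> modforms m N"
  shows "homogeneous_bracket k f m g \<in> modforms (k + m + 2) N"
proof -
  have h: "holo_with_cusps k f" "holo_with_cusps m g"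
    using f g by (simp_all add: modforms_def)
  note hol = modforms_holomorphic[OF f] modforms_holomorphic[OF g]
  have "slash (k + m + 2) a b c d (homogeneous_bracket k f m g) z = homogeneous_bracket k f m g z"
    if "a * d - b * c = 1" "int N dvd c" "int N dvd a - 1" "int N dvd d - 1" "z \<in> upper_half" for a b c d z
  proof -
    have "slash (k + m + 2) a b c d (homogeneous_bracket k f m g) z
            = 1 * 1 * homogeneous_bracket k f m g z"
      using that f g by (intro slash_bracket_eigen[OF hol]) (simp_all add: modforms_def)
    then show ?thesis by simp
  qed
  then show ?thesis
    unfolding modforms_def using holo_with_cusps_bracket[OF h] by blast
qed

lemma modforms_char_subset:
  assumes "dirichlet_char N \<psi>" "f \<in> modforms_char k N \<psi>"
  shows "f \<in> modforms k N"
proof -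
  have "\<psi> d = 1" if "int N dvd d - 1" for d
    using dirichlet_char_cong[OF assms(1), of d 1] dirichlet_char_one[OF assms(1)] that
    by (simp add: cong_iff_dvd_diff)
  then show ?thesis
    using assms(2) by (auto simp: modforms_char_def modforms_def)
qed

lemma modforms_q_expansion:
  assumes "f \<in> modforms k N"
  shows "\<exists>a. has_q_expansion f a"
proof -
  have "\<exists>Y. bounded (slash k 1 0 0 1 f ` {z. Im z > Y})"
    by (rule modforms_bounded_at_cusps[OF assms]) simp
  moreover have "slash k 1 0 0 1 f = f"
    by (auto simp: slash_def mobius_def)
  ultimately obtain Y where Y: "bounded (f ` {z. Im z > Y})" by auto
  have "slash k 1 1 0 1 f z = f z" if "z \<in> upper_half" for z
    using assms that by (simp add: modforms_def)
  then have "f (z + 1) = f z" if "z \<in> upper_half" for z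
    using that by (simp add: slash_def mobius_def)
  then show ?thesis
    using has_q_expansion_periodic[OF modforms_holomorphic[OF assms] _ Y] by blast
qed

section \<open>The graded algebra\<close>

lemma modforms_zero [simp]: "(\<lambda>_. 0) \<in> modforms k N"
proof -
  have "slash k a b c d (\<lambda>_. 0) = (\<lambda>_. 0)" for a b c d
    by (auto simp: slash_def)
  moreover have "bounded ((\<lambda>_. 0 :: complex) ` S)" for S :: "complex set"
    by (rule bounded_subset[of "{0}"]) auto
  ultimately show ?thesis
    by (simp add: modforms_def holo_with_cusps_def)
qed

lemma modforms_add:
  assumes f: "f \<in> modforms k N" and g: "g \<in> modforms k N"
  shows "(\<lambda>z. f z + g z) \<in> modforms k N"
proof -
  have s: "slash k a b c d (\<lambda>z. f z + g z) = (\<lambda>z. slash k a b c d f z + slash k a b c d g z)" for a b c d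
    by (auto simp: slash_def add_divide_distrib)
  have "\<exists>Y. bounded (slash k a b c d (\<lambda>z. f z + g z) ` {z. Im z > Y})" if det: "a * d - b * c = 1" for a b c d
  proof -
    obtain Y Y' where Y: "bounded (slash k a b c d f ` {z. Im z > Y})" "bounded (slash k a b c d g ` {z. Im z > Y'})"
      using modforms_bounded_at_cusps[OF f det] modforms_bounded_at_cusps[OF g det] by blast
    have "bounded ((\<lambda>z. slash k a b c d f z + slash k a b c d g z) ` {z. Im z > max Y Y'})"
      by (intro bounded_plus_comp bounded_subset[OF Y(1)] bounded_subset[OF Y(2)]) auto
    then show ?thesis unfolding s by blast
  qed
  then show ?thesis
    using f g by (simp add: modforms_def holo_with_cusps_def s holomorphic_on_add)
qed

lemma slash_scale: "slash k a b c d (\<lambda>z. x * f z) z = x * slash k a b c d f z"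
  by (simp add: slash_def)

lemma holo_with_cusps_scale:
  assumes f: "holo_with_cusps k f"
  shows "holo_with_cusps k (\<lambda>z. x * f z)"
proof -
  have "\<exists>Y. bounded (slash k a b c d (\<lambda>z. x * f z) ` {z. Im z > Y})" if det: "a * d - b * c = 1" for a b c d
  proof -
    obtain Y where "bounded (slash k a b c d f ` {z. Im z > Y})"
      using f det unfolding holo_with_cusps_def by blast
    then obtain B where "\<And>z. Im z > Y \<Longrightarrow> norm (slash k a b c d f z) \<le> B"
      unfolding bounded_iff by auto
    then have "bounded (slash k a b c d (\<lambda>z. x * f z) ` {z. Im z > Y})"
      unfolding bounded_iff
      by (intro exI[of _ "norm x * B"]) (auto simp: slash_scale norm_mult intro: mult_left_mono)
    then show ?thesis by blast
  qed
  then show ?thesis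
    using f by (simp add: holo_with_cusps_def holomorphic_on_mult)
qed

lemma modforms_scale: "f \<in> modforms k N \<Longrightarrow> (\<lambda>z. x * f z) \<in> modforms k N"
  by (simp add: modforms_def holo_with_cusps_scale slash_scale)

lemma modforms_char_scale: "f \<in> modforms_char k N \<epsilon> \<Longrightarrow> (\<lambda>z. x * f z) \<in> modforms_char k N \<epsilon>"
  by (simp add: modforms_char_def holo_with_cusps_scale slash_scale)

text \<open>
  The matrices with rows \<open>(1, 0)\<close> and \<open>(N m, 1)\<close> turn a vanishing sum of forms into a polynomial
  in the automorphy factor \<open>N m z + 1\<close>, whose coefficients are the values of the forms at \<open>z\<close> and
  which has infinitely many zeros as \<open>m\<close> varies.
\<close>

lemma modforms_independent:
  assumes "N > 0" "finite S" and F: "\<And>k. k \<in> S \<Longrightarrow> F k \<in> modforms k N"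
    and zero: "\<And>z. (\<Sum>k\<in>S. F k z) = 0" and "k \<in> S"
  shows "F k z = 0"
proof (cases "z \<in> upper_half")
  case z: True
  define P where "P = (\<Sum>k\<in>S. Polynomial.monom (F k z) k)"
  have "poly P (of_nat (N * m) * z + 1) = 0" for m :: nat
  proof -
    have "F k (mobius 1 0 (int (N * m)) 1 z) = F k z * (of_nat (N * m) * z + 1) ^ k" if "k \<in> S" for k
    proof -
      have "slash k 1 0 (int (N * m)) 1 (F k) z = F k z"
        using F[OF that] z by (simp add: modforms_def)
      moreover have "of_int (int (N * m)) * z + of_int 1 \<noteq> 0"
        using automorphy_factor_nonzero[of 1 1 0 "int (N * m)" z] z by simp
      ultimately show ?thesis by (simp add: slash_def field_simps)
    qed
    then have "poly P (of_nat (N * m) * z + 1) = (\<Sum>k\<in>S. F k (mobius 1 0 (int (N * m)) 1 z))"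
      by (simp add: P_def poly_sum poly_monom)
    then show ?thesis using zero by simp
  qed
  then have "range (\<lambda>m. of_nat (N * m) * z + 1) \<subseteq> {x. poly P x = 0}"
    by blast
  moreover have "inj (\<lambda>m. of_nat (N * m) * z + 1)"
    using z assms(1) by (auto simp: inj_on_def upper_half_def)
  then have "infinite (range (\<lambda>m. of_nat (N * m) * z + 1))"
    by (rule range_inj_infinite)
  ultimately have "P = 0"
    using poly_roots_finite infinite_super by blast
  moreover have "poly.coeff P k = F k z"
    using assms(2,5) by (simp add: P_def coeff_sum)
  ultimately show ?thesis by simp
next
  case False
  then show ?thesis using F[OF assms(5)] by (simp add: modforms_def holo_with_cusps_def)
qed

lemma homogeneous_decomp_sum:
  assumes "homogeneous_decomp N g F" "finite S" "{k. F k \<noteq> (\<lambda>_. 0)} \<subseteq> S"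
  shows "g z = (\<Sum>k\<in>S. F k z)"
proof -
  have "g z = (\<Sum>k | F k \<noteq> (\<lambda>_. 0). F k z)"
    using assms(1) unfolding homogeneous_decomp_def by metis
  also have "\<dots> = (\<Sum>k\<in>S. F k z)"
    using assms by (intro sum.mono_neutral_left) auto
  finally show ?thesis .
qed

lemma homogeneous_decompI:
  assumes "finite S" "\<And>k. F k \<in> modforms k N" "{k. F k \<noteq> (\<lambda>_. 0)} \<subseteq> S"
    and "\<And>z. g z = (\<Sum>k\<in>S. F k z)"
  shows "homogeneous_decomp N g F"
proof -
  have "g z = (\<Sum>k | F k \<noteq> (\<lambda>_. 0). F k z)" for z
    unfolding assms(4) using assms(1,3) by (intro sum.mono_neutral_right) auto
  then show ?thesis
    unfolding homogeneous_decomp_def using assms finite_subset by blast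
qed

lemma homogeneous_decomp_unique:
  assumes "N > 0" and F: "homogeneous_decomp N g F" and G: "homogeneous_decomp N g G"
  shows "F = G"
proof (intro ext)
  fix k z
  define S where "S = insert k ({k. F k \<noteq> (\<lambda>_. 0)} \<union> {k. G k \<noteq> (\<lambda>_. 0)})"
  have S: "finite S" using F G by (simp add: S_def homogeneous_decomp_def)
  have "F k z + (- 1) * G k z = 0"
  proof (rule modforms_independent[OF assms(1) S, of "\<lambda>k z. F k z + (- 1) * G k z"])
    show "(\<lambda>z. F k z + (- 1) * G k z) \<in> modforms k N" for k
      using F G by (intro modforms_add modforms_scale) (auto simp: homogeneous_decomp_def)
    show "(\<Sum>k\<in>S. F k z + (- 1) * G k z) = 0" for z
    proof -
      have "g z = (\<Sum>k\<in>S. F k z)"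
        by (rule homogeneous_decomp_sum[OF F S]) (auto simp: S_def)
      moreover have "g z = (\<Sum>k\<in>S. G k z)"
        by (rule homogeneous_decomp_sum[OF G S]) (auto simp: S_def)
      ultimately show ?thesis by (simp add: sum_subtractf)
    qed
  qed (simp add: S_def)
  then show "F k z = G k z" by simp
qed

lemma component_eq: "N > 0 \<Longrightarrow> homogeneous_decomp N g F \<Longrightarrow> component N g = F"
  unfolding component_def by (rule the_equality) (auto intro: homogeneous_decomp_unique)

lemma homogeneous_decomp_single:
  "f \<in> modforms k N \<Longrightarrow> homogeneous_decomp N f (\<lambda>i. if i = k then f else (\<lambda>_. 0))"
  by (rule homogeneous_decompI[of "{k}"]) auto

lemma homogeneous_decomp_add:
  assumes F: "homogeneous_decomp N g F" and H: "homogeneous_decomp N h H"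
  shows "homogeneous_decomp N (\<lambda>z. g z + h z) (\<lambda>k z. F k z + H k z)"
proof -
  define S where "S = {k. F k \<noteq> (\<lambda>_. 0)} \<union> {k. H k \<noteq> (\<lambda>_. 0)}"
  have S: "finite S" using F H by (simp add: S_def homogeneous_decomp_def)
  show ?thesis
  proof (rule homogeneous_decompI[OF S])
    show "(\<lambda>z. F k z + H k z) \<in> modforms k N" for k
      using F H by (intro modforms_add) (auto simp: homogeneous_decomp_def)
    show "g z + h z = (\<Sum>k\<in>S. F k z + H k z)" for z
      using homogeneous_decomp_sum[OF F S, of z] homogeneous_decomp_sum[OF H S, of z]
      by (auto simp: sum.distrib S_def)
  qed (auto simp: S_def)
qed

lemma homogeneous_decomp_scale:
  assumes F: "homogeneous_decomp N g F"
  shows "homogeneous_decomp N (\<lambda>z. c * g z) (\<lambda>k z. c * F k z)"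
proof -
  define S where "S = {k. F k \<noteq> (\<lambda>_. 0)}"
  have S: "finite S" using F by (simp add: S_def homogeneous_decomp_def)
  show ?thesis
  proof (rule homogeneous_decompI[OF S])
    show "(\<lambda>z. c * F k z) \<in> modforms k N" for k
      using F by (intro modforms_scale) (auto simp: homogeneous_decomp_def)
    show "c * g z = (\<Sum>k\<in>S. c * F k z)" for z
      using homogeneous_decomp_sum[OF F S, of z] by (simp add: sum_distrib_left S_def)
  qed (auto simp: S_def)
qed

lemma modforms_alg_sum:
  assumes "finite S" "\<And>i. i \<in> S \<Longrightarrow> f i \<in> modforms_alg N"
  shows "(\<lambda>z. \<Sum>i\<in>S. f i z) \<in> modforms_alg N"
  using assms
proof (induction S rule: finite_induct)
  case empty
  show ?case
    unfolding modforms_alg_def using homogeneous_decomp_single[OF modforms_zero] by auto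
next
  case (insert i S)
  then show ?case
    unfolding modforms_alg_def using homogeneous_decomp_add[of N "f i" _ "\<lambda>z. \<Sum>i\<in>S. f i z"] by force
qed

lemma modforms_imp_alg: "f \<in> modforms k N \<Longrightarrow> f \<in> modforms_alg N"
  unfolding modforms_alg_def using homogeneous_decomp_single by blast

text \<open>
  The sums are over the nonzero components, which vary with \<open>g\<close>; linearity needs them over a
  common finite set of weights.
\<close>

lemma theta_tilde_eq:
  assumes "N > 0" and A: "A \<in> modforms kA N" and F: "homogeneous_decomp N g F"
    and S: "finite S" "{k. F k \<noteq> (\<lambda>_. 0)} \<subseteq> S"
  shows "theta_tilde N kA A g z = (\<Sum>k\<in>S. - (1 / of_nat kA) * homogeneous_bracket k (F k) kA A z)"
proof -
  have cA: "component N A = (\<lambda>j. if j = kA then A else (\<lambda>_. 0))"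
    by (rule component_eq[OF assms(1) homogeneous_decomp_single[OF A]])
  have "(\<Sum>j | component N A j \<noteq> (\<lambda>_. 0). homogeneous_bracket i (F i) j (component N A j) z)
          = (\<Sum>j\<in>{kA}. homogeneous_bracket i (F i) j (component N A j) z)" for i
    by (rule sum.mono_neutral_left) (auto simp: cA)
  then have "rankin_cohen N g A z = (\<Sum>k | F k \<noteq> (\<lambda>_. 0). homogeneous_bracket k (F k) kA A z)"
    unfolding rankin_cohen_def component_eq[OF assms(1) F] by (simp add: cA)
  also have "\<dots> = (\<Sum>k\<in>S. homogeneous_bracket k (F k) kA A z)"
    using S by (intro sum.mono_neutral_left) auto
  finally show ?thesis by (simp only: theta_tilde_def sum_distrib_left)
qed

lemma theta_tilde_homogeneous:
  assumes "N > 0" "A \<in> modforms kA N" "g \<in> modforms k N"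
  shows "theta_tilde N kA A g = (\<lambda>z. - (1 / of_nat kA) * homogeneous_bracket k g kA A z)"
proof
  fix z
  have "theta_tilde N kA A g z = (\<Sum>i\<in>{k}. - (1 / of_nat kA) *
          homogeneous_bracket i (if i = k then g else (\<lambda>_. 0)) kA A z)"
    by (rule theta_tilde_eq[OF assms(1,2) homogeneous_decomp_single[OF assms(3)]])
       (auto split: if_splits)
  then show "theta_tilde N kA A g z = - (1 / of_nat kA) * homogeneous_bracket k g kA A z"
    by simp
qed

lemma theta_tilde_closed:
  assumes "N > 0" "A \<in> modforms kA N" "g \<in> modforms_alg N"
  shows "theta_tilde N kA A g \<in> modforms_alg N"
proof -
  obtain F where F: "homogeneous_decomp N g F"
    using assms(3) by (auto simp: modforms_alg_def)
  have fin: "finite {k. F k \<noteq> (\<lambda>_. 0)}" and F_mod: "\<And>k. F k \<in> modforms k N"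
    using F by (auto simp: homogeneous_decomp_def)
  show ?thesis
    unfolding theta_tilde_eq[OF assms(1,2) F fin order_refl, abs_def]
    by (rule modforms_alg_sum[OF fin] modforms_imp_alg modforms_scale bracket_modforms[OF F_mod assms(2)])+
qed

lemma theta_tilde_add:
  assumes "N > 0" "A \<in> modforms kA N" "g \<in> modforms_alg N" "h \<in> modforms_alg N"
  shows "theta_tilde N kA A (\<lambda>z. g z + h z) z = theta_tilde N kA A g z + theta_tilde N kA A h z"
proof -
  obtain F H where F: "homogeneous_decomp N g F" and H: "homogeneous_decomp N h H"
    using assms(3,4) by (auto simp: modforms_alg_def)
  define S where "S = {k. F k \<noteq> (\<lambda>_. 0)} \<union> {k. H k \<noteq> (\<lambda>_. 0)}"
  have S: "finite S" using F H by (simp add: S_def homogeneous_decomp_def)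
  have hol: "F k holomorphic_on upper_half" "H k holomorphic_on upper_half" for k
    using F H by (auto simp: homogeneous_decomp_def intro: modforms_holomorphic)
  note eq = theta_tilde_eq[OF assms(1,2) _ S, of _ _ z]
  have "theta_tilde N kA A (\<lambda>z. g z + h z) z
          = (\<Sum>k\<in>S. - (1 / of_nat kA) * homogeneous_bracket k (\<lambda>z. F k z + H k z) kA A z)"
    by (rule eq[OF homogeneous_decomp_add[OF F H]]) (auto simp: S_def)
  also have "\<dots> = (\<Sum>k\<in>S. - (1 / of_nat kA) * homogeneous_bracket k (F k) kA A z)
                + (\<Sum>k\<in>S. - (1 / of_nat kA) * homogeneous_bracket k (H k) kA A z)"
    by (simp only: bracket_add_left[OF hol] distrib_left sum.distrib)
  also have "\<dots> = theta_tilde N kA A g z + theta_tilde N kA A h z"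
    using eq[OF F] eq[OF H] by (auto simp: S_def)
  finally show ?thesis .
qed

lemma theta_tilde_scale:
  assumes "N > 0" "A \<in> modforms kA N" "g \<in> modforms_alg N"
  shows "theta_tilde N kA A (\<lambda>z. c * g z) z = c * theta_tilde N kA A g z"
proof -
  obtain F where F: "homogeneous_decomp N g F"
    using assms(3) by (auto simp: modforms_alg_def)
  define S where "S = {k. F k \<noteq> (\<lambda>_. 0)}"
  have S: "finite S" using F by (simp add: S_def homogeneous_decomp_def)
  have hol: "F k holomorphic_on upper_half" for k
    using F by (auto simp: homogeneous_decomp_def intro: modforms_holomorphic)
  note eq = theta_tilde_eq[OF assms(1,2) _ S, of _ _ z]
  have "theta_tilde N kA A (\<lambda>z. c * g z) z
          = (\<Sum>k\<in>S. - (1 / of_nat kA) * homogeneous_bracket k (\<lambda>z. c * F k z) kA A z)"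
    by (rule eq[OF homogeneous_decomp_scale[OF F]]) (auto simp: S_def)
  also have "\<dots> = (\<Sum>k\<in>S. c * (- (1 / of_nat kA) * homogeneous_bracket k (F k) kA A z))"
    by (simp only: bracket_scale_left[OF hol] mult.left_commute)
  also have "\<dots> = c * theta_tilde N kA A g z"
    using eq[OF F] by (simp add: sum_distrib_left S_def)
  finally show ?thesis .
qed

section \<open>Congruences for the coefficients\<close>

text \<open>
  Written as \<open>A \<theta>g - k g (\<theta>A / k\<^sub>A)\<close>, this multiple of the bracket involves \<open>A\<close> only through the two forms whose
  coefficients are controlled, even when \<open>k\<^sub>A\<close> is not invertible modulo \<open>L\<close>.
\<close>

lemma has_q_expansion_bracket:
  assumes g: "has_q_expansion g a" and A: "has_q_expansion A \<alpha>" and "kA > 0"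
  shows "has_q_expansion (\<lambda>z. - (1 / of_nat kA) * homogeneous_bracket k g kA A z)
           (\<lambda>n. (\<Sum>i\<le>n. \<alpha> i * (of_nat (n - i) * a (n - i)))
                - of_nat k * (\<Sum>i\<le>n. a i * (1 / of_nat kA * (of_nat (n - i) * \<alpha> (n - i)))))"
proof -
  have "has_q_expansion (\<lambda>z. A z * theta g z - of_nat k * (g z * (1 / of_nat kA * theta A z)))
           (\<lambda>n. (\<Sum>i\<le>n. \<alpha> i * (of_nat (n - i) * a (n - i)))
                - of_nat k * (\<Sum>i\<le>n. a i * (1 / of_nat kA * (of_nat (n - i) * \<alpha> (n - i)))))"
    using g A by (intro has_q_expansion_diff has_q_expansion_scale has_q_expansion_mult has_q_expansion_theta)
  moreover have "A z * theta g z - of_nat k * (g z * (1 / of_nat kA * theta A z))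
                   = - (1 / of_nat kA) * homogeneous_bracket k g kA A z" for z
    using assms(3) by (simp add: homogeneous_bracket_def field_simps)
  ultimately show ?thesis by simp
qed

context algebraic_place
begin

lemma L_cong_convolution:
  fixes \<alpha> x :: "nat \<Rightarrow> complex"
  assumes "\<And>i. L_cong L (\<alpha> i) (if i = 0 then 1 else 0)" and "\<And>i. x i \<in> L_integers L"
  shows "L_cong L (\<Sum>i\<le>n. \<alpha> i * x (n - i)) (x n)"
proof -
  have "L_cong L (\<Sum>i\<le>n. x (n - i) * \<alpha> i) (\<Sum>i\<le>n. x (n - i) * (if i = 0 then 1 else 0))"
    by (intro L_cong_sum L_cong_scale assms)
  also have "(\<Sum>i\<le>n. x (n - i) * (if i = 0 then 1 else 0)) = x n"
    by (simp add: if_distrib cong: if_cong)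
  finally show ?thesis by (simp add: mult.commute)
qed

lemma L_cong_convolution_zero:
  fixes \<beta> x :: "nat \<Rightarrow> complex"
  assumes "\<And>i. L_cong L (\<beta> i) 0" and "\<And>i. x i \<in> L_integers L"
  shows "L_cong L (\<Sum>i\<le>n. x i * \<beta> (n - i)) 0"
proof -
  have "L_cong L (\<Sum>i\<le>n. x i * \<beta> (n - i)) (\<Sum>i\<le>n. x i * 0)"
    by (intro L_cong_sum L_cong_scale assms)
  then show ?thesis by simp
qed

text \<open>
  Here \<open>e\<close> is \<open>\<epsilon>(p)\<close>, \<open>x\<close> is \<open>p\<^bsup>kA\<^esup> \<chi>\<^sub>A(p)\<close> and \<open>t\<close> is \<open>p\<^bsup>k-1\<^esup>\<close>.  Multiplied by \<open>n p\<close>, the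
  \<open>n\<close>-th coefficient of \<open>T\<^sub>p g\<close> becomes \<open>(n p) a\<^bsub>np\<^esub> + p\<^bsup>k+1\<^esup> \<epsilon>(p) (n/p) a\<^bsub>n/p\<^esub>\<close>, which is that of
  the Hecke operator of weight \<open>k + 2\<close> applied to \<open>\<theta>g\<close>; the remaining shift by \<open>kA\<close> is undone by
  \<open>\<chi>\<^sub>A\<close>.  Stating \<open>p t = p\<^sup>k\<close> instead of integrality of \<open>t\<close> covers weight zero, where
  \<open>t = p\<^sup>-\<^sup>1\<close> may fail to be integral.
\<close>

lemma hecke_eigenvalue_twist:
  fixes a c :: "nat \<Rightarrow> complex"
  assumes a: "\<And>n. a n \<in> L_integers L" and c: "\<And>n. L_cong L (c n) (of_nat n * a n)"
    and e: "e \<in> L_integers L" and x: "x \<in> L_integers L" and ap: "ap \<in> L_integers L"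
    and twist: "L_cong L (of_nat p * (x * e)) (of_nat p * e)"
    and t: "of_nat p * t = of_nat p ^ k"
    and eigen: "\<And>n. L_cong L (a (n * p) + t * e * (if p dvd n then a (n div p) else 0)) (ap * a n)"
  shows "L_cong L (c (n * p) + of_nat p ^ k * (of_nat p * (x * e)) * (if p dvd n then c (n div p) else 0))
           (of_nat p * ap * c n)"
proof -
  define a' where "a' = (if p dvd n then a (n div p) else 0)"
  define c' where "c' = (if p dvd n then c (n div p) else 0)"
  have a': "a' \<in> L_integers L" using a by (simp add: a'_def)
  have c': "L_cong L c' (of_nat (n div p) * a')" using c by (simp add: a'_def c'_def)
  have shift: "of_nat p * of_nat (n div p) * a' = of_nat n * a'"
    by (auto simp: a'_def simp flip: of_nat_mult)
  have "L_cong L (of_nat p ^ k * (of_nat p * (x * e)) * c')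
          (of_nat p ^ k * (of_nat p * (x * e)) * (of_nat (n div p) * a'))"
    using e x by (intro L_cong_scale[OF c'] L_integers_mult L_integers_power) auto
  also have "L_cong L \<dots> (of_nat p ^ k * (of_nat p * e) * (of_nat (n div p) * a'))"
    using L_cong_scale[OF twist, of "of_nat p ^ k * (of_nat (n div p) * a')"] a'
    by (simp add: L_integers_mult L_integers_power mult_ac)
  also have "of_nat p ^ k * (of_nat p * e) * (of_nat (n div p) * a')
               = of_nat p ^ k * e * (of_nat p * of_nat (n div p) * a')"
    by (simp add: mult_ac)
  also have "\<dots> = of_nat p * of_nat n * (t * e * a')"
    unfolding shift t[symmetric] by (simp add: mult_ac)
  finally have 1: "L_cong L (of_nat p ^ k * (of_nat p * (x * e)) * c') (of_nat p * of_nat n * (t * e * a'))" .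
  have "L_cong L (c (n * p) + of_nat p ^ k * (of_nat p * (x * e)) * c')
          (of_nat (n * p) * a (n * p) + of_nat p * of_nat n * (t * e * a'))"
    by (rule L_cong_add[OF c 1])
  also have "of_nat (n * p) * a (n * p) + of_nat p * of_nat n * (t * e * a')
               = of_nat p * of_nat n * (a (n * p) + t * e * a')"
    by (simp add: algebra_simps)
  also have "L_cong L \<dots> (of_nat p * of_nat n * (ap * a n))"
    unfolding a'_def by (intro L_cong_scale[OF eigen] L_integers_mult) auto
  also have "of_nat p * of_nat n * (ap * a n) = of_nat p * ap * (of_nat n * a n)"
    by (simp add: mult_ac)
  also have "L_cong L \<dots> (of_nat p * ap * c n)"
    using ap by (intro L_cong_scale[OF L_cong_sym[OF c]] L_integers_mult) auto
  finally show ?thesis unfolding c'_def .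
qed

text \<open>
  The factor \<open>p\<close> absorbs the case \<open>p = \<ell>\<close>, about which the hypothesis on \<open>\<psi>\<close> says nothing.
\<close>

lemma character_twist:
  assumes l: "prime l" "of_nat l \<in> L" and p: "prime p" and N: "N > 0"
    and \<epsilon>: "dirichlet_char N \<epsilon>" and \<psi>: "dirichlet_char N \<psi>"
    and cyc: "\<forall>n :: int. coprime n (int (N * l)) \<longrightarrow> L_cong L (\<psi> n * of_int n ^ m) 1"
  shows "L_cong L (of_nat p * (of_nat p ^ m * \<psi> (int p) * \<epsilon> (int p))) (of_nat p * \<epsilon> (int p))"
proof -
  have e: "\<epsilon> (int p) \<in> L_integers L" and x: "\<psi> (int p) \<in> L_integers L"
    using algebraic_int_dirichlet_char \<epsilon> \<psi> N by (auto intro: L_integers_algint)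
  consider "p dvd N" | "p = l" | "\<not> p dvd N" "p \<noteq> l" by blast
  then show ?thesis
  proof cases
    case 1
    then have "\<not> coprime (int p) (int N)"
      using p by (metis coprime_int_iff coprime_absorb_left not_prime_unit)
    then have "\<epsilon> (int p) = 0" using \<epsilon> by (simp add: dirichlet_char_def)
    then show ?thesis by simp
  next
    case 2
    then have p0: "of_nat p \<in> L_maximal L" using l(2) by (intro L_maximal_place) simp
    show ?thesis
      unfolding L_cong_def
      using e x by (intro L_maximal_diff L_maximal_mult[OF p0] L_integers_mult L_integers_power) auto
  next
    case 3
    then have "coprime p (N * l)"
      using p l(1) by (simp add: prime_imp_coprime primes_coprime)
    then have "L_cong L (\<psi> (int p) * of_int (int p) ^ m) 1"
      using cyc by (metis coprime_int_iff)
    from L_cong_scale[OF this, of "of_nat p * \<epsilon> (int p)"] e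
    show ?thesis by (simp add: L_integers_mult mult_ac)
  qed
qed

text \<open>
  Comparing first coefficients, where \<open>T\<^sub>p g\<close> has \<open>a\<^sub>p\<close> and \<open>g\<close> has \<open>1\<close> modulo \<open>L\<close>,
  identifies the eigenvalue.
\<close>

lemma eigenform_modD:
  assumes ev: "eigenform_mod L k \<epsilon> p g ev" and norm: "normalised_mod L g"
    and g: "has_q_expansion g a" and p: "prime p"
  shows "L_cong L (a (n * p) + of_nat p powi (int k - 1) * \<epsilon> (int p) * (if p dvd n then a (n div p) else 0))
           (a p * a n)"
    (is "L_cong L (?b n) _")
proof -
  have a: "a n \<in> L_integers L" for n
    using ev qcoeff_eq[OF g] by (simp add: eigenform_mod_def L_integral_coeffs_def)
  obtain x where x: "x \<in> L_integers L" "ev = reduction L x"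
    using ev by (auto simp: eigenform_mod_def carrier_residue_field)
  have "qcoeff (hecke k \<epsilon> p g) = ?b"
    using qcoeff_eq[OF has_q_expansion_hecke[OF g]] p by (simp add: prime_gt_0_nat)
  then have b: "L_cong L (?b n) (x * a n)" for n
    using ev x a by (simp add: eigenform_mod_def qcoeff_eq[OF g] reduction_mult reduction_eq_iff)
  have "\<not> p dvd 1" using p not_prime_unit by blast
  then have "?b 1 = a p" by (simp only: if_False mult_zero_right add_0_right mult_1)
  then have "L_cong L (a p) (x * a 1)"
    using b[of 1] by (simp only:)
  also have "L_cong L \<dots> (x * 1)"
    using norm by (intro L_cong_scale x) (simp add: normalised_mod_def qcoeff_eq[OF g])
  finally have ap: "L_cong L x (a p)" by (simp add: L_cong_sym)
  note b[of n]
  also have "L_cong L (x * a n) (a p * a n)"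
    using L_cong_scale[OF ap a[of n]] by (simp add: mult.commute)
  finally show ?thesis .
qed

end

theorem lemma3p2:
  fixes l N kA :: nat and L :: "complex set"
    and chiA :: "int \<Rightarrow> complex" and A :: "complex \<Rightarrow> complex"
  assumes "prime l" and "place_above l L" and "N > 0" and "kA > 0"
    and "dirichlet_char N chiA" and "A \<in> modforms_char kA N chiA"
    and "L_integral_coeffs L A"
    and "L_integral_coeffs L (\<lambda>z. 1 / of_nat kA * theta A z)"
    and "form_cong L A (\<lambda>_. 1)"
    and "form_cong L (\<lambda>z. 1 / of_nat kA * theta A z) (\<lambda>_. 0)"
    and "\<forall>n :: int. coprime n (int (N * l)) \<longrightarrow> L_cong L (chiA n * of_int n ^ kA) 1"
  shows
    "(\<forall>g\<in>modforms_alg N. \<exists>!F. homogeneous_decomp N g F) \<and>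
     (\<forall>g\<in>modforms_alg N. theta_tilde N kA A g \<in> modforms_alg N) \<and>
     (\<forall>g\<in>modforms_alg N. \<forall>h\<in>modforms_alg N.
        theta_tilde N kA A (\<lambda>z. g z + h z)
          = (\<lambda>z. theta_tilde N kA A g z + theta_tilde N kA A h z)) \<and>
     (\<forall>g\<in>modforms_alg N. \<forall>c :: complex.
        theta_tilde N kA A (\<lambda>z. c * g z) = (\<lambda>z. c * theta_tilde N kA A g z)) \<and>
     (\<forall>k. \<forall>g\<in>modforms k N.
        theta_tilde N kA A g = (\<lambda>z. - (1 / of_nat kA) * homogeneous_bracket k g kA A z)) \<and>
     (\<forall>k \<epsilon> g. dirichlet_char N \<epsilon> \<longrightarrow> g \<in> modforms_char k N \<epsilon> \<longrightarrow> L_integral_coeffs L g \<longrightarrow>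
        theta_tilde N kA A g \<in> modforms_char (k + kA + 2) N (\<lambda>n. \<epsilon> n * chiA n) \<and>
        L_integral_coeffs L (theta_tilde N kA A g) \<and>
        form_cong L (theta_tilde N kA A g) (theta g) \<and>
        (\<forall>p. prime p \<longrightarrow> (\<exists>ev. eigenform_mod L k \<epsilon> p g ev) \<longrightarrow> normalised_mod L g \<longrightarrow>
           eigenform_mod L (k + kA + 2) (\<lambda>n. \<epsilon> n * chiA n) p (theta_tilde N kA A g)
             (reduction L (of_nat p * qcoeff g p)) \<and>
           normalised_mod L (theta_tilde N kA A g)))"
proof -
  have place: "maximalideal L algint_ring" "of_nat l \<in> L"
    using assms(2) by (auto simp: place_above_def)
  interpret algebraic_place L by (rule algebraic_place.intro[OF place(1)])
  note N = \<open>N > 0\<close> and kA = \<open>kA > 0\<close> and chiA = \<open>dirichlet_char N chiA\<close>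
  have A: "A \<in> modforms kA N"
    using modforms_char_subset[OF chiA] assms(6) .
  obtain \<alpha> where \<alpha>: "has_q_expansion A \<alpha>"
    using modforms_q_expansion[OF A] ..
  define \<beta> where "\<beta> = (\<lambda>n. 1 / of_nat kA * (of_nat n * \<alpha> n))"
  have \<beta>: "has_q_expansion (\<lambda>z. 1 / of_nat kA * theta A z) \<beta>"
    unfolding \<beta>_def by (intro has_q_expansion_scale has_q_expansion_theta \<alpha>)
  have \<alpha>_int: "\<alpha> n \<in> L_integers L" and \<beta>_int: "\<beta> n \<in> L_integers L"
    and \<alpha>_cong: "L_cong L (\<alpha> n) (if n = 0 then 1 else 0)" and \<beta>_cong: "L_cong L (\<beta> n) 0" for n
    using assms(7-10)
    unfolding L_integral_coeffs_def form_cong_def qcoeff_eq[OF \<alpha>] qcoeff_eq[OF \<beta>]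
      qcoeff_eq[OF has_q_expansion_one] qcoeff_eq[OF has_q_expansion_zero]
    by blast+

  have main: "theta_tilde N kA A g \<in> modforms_char (k + kA + 2) N (\<lambda>n. \<epsilon> n * chiA n) \<and>
        L_integral_coeffs L (theta_tilde N kA A g) \<and>
        form_cong L (theta_tilde N kA A g) (theta g) \<and>
        (\<forall>p. prime p \<longrightarrow> (\<exists>ev. eigenform_mod L k \<epsilon> p g ev) \<longrightarrow> normalised_mod L g \<longrightarrow>
           eigenform_mod L (k + kA + 2) (\<lambda>n. \<epsilon> n * chiA n) p (theta_tilde N kA A g)
             (reduction L (of_nat p * qcoeff g p)) \<and>
           normalised_mod L (theta_tilde N kA A g))"
    if \<epsilon>: "dirichlet_char N \<epsilon>" and g_char: "g \<in> modforms_char k N \<epsilon>" and g_int: "L_integral_coeffs L g"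
    for k \<epsilon> g
  proof -
    have g: "g \<in> modforms k N"
      using modforms_char_subset[OF \<epsilon> g_char] .
    obtain a where a: "has_q_expansion g a"
      using modforms_q_expansion[OF g] ..
    have a_int: "a n \<in> L_integers L" for n
      using g_int qcoeff_eq[OF a] by (simp add: L_integral_coeffs_def)
    note tilde = theta_tilde_homogeneous[OF N A g]
    define c where "c = (\<lambda>n. (\<Sum>i\<le>n. \<alpha> i * (of_nat (n - i) * a (n - i)))
                              - of_nat k * (\<Sum>i\<le>n. a i * \<beta> (n - i)))"
    have c: "has_q_expansion (theta_tilde N kA A g) c"
      unfolding tilde c_def \<beta>_def by (rule has_q_expansion_bracket[OF a \<alpha> kA])
    have na_int: "of_nat n * a n \<in> L_integers L" for n
      by (intro L_integers_mult a_int) simp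
    have c_int: "c n \<in> L_integers L" for n
      unfolding c_def
      by (intro L_integers_diff L_integers_mult L_integers_sum \<alpha>_int \<beta>_int a_int L_integers_of_nat)
    have "L_cong L (c n) (of_nat n * a n - of_nat k * 0)" for n
      unfolding c_def
      by (intro L_cong_diff L_cong_scale L_integers_of_nat
            L_cong_convolution[where x = "\<lambda>n. of_nat n * a n"] L_cong_convolution_zero
            \<alpha>_cong \<beta>_cong a_int na_int)
    then have c_cong: "L_cong L (c n) (of_nat n * a n)" for n by simp

    have "theta_tilde N kA A g \<in> modforms_char (k + kA + 2) N (\<lambda>n. \<epsilon> n * chiA n)"
      unfolding tilde by (intro modforms_char_scale bracket_modforms_char g_char assms(6))
    moreover have "L_integral_coeffs L (theta_tilde N kA A g)"
      using c_int by (simp add: L_integral_coeffs_def qcoeff_eq[OF c])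
    moreover have "form_cong L (theta_tilde N kA A g) (theta g)"
      using c_cong by (simp add: form_cong_def qcoeff_eq[OF c] qcoeff_eq[OF has_q_expansion_theta[OF a]])
    moreover have "eigenform_mod L (k + kA + 2) (\<lambda>n. \<epsilon> n * chiA n) p (theta_tilde N kA A g)
             (reduction L (of_nat p * qcoeff g p)) \<and> normalised_mod L (theta_tilde N kA A g)"
      if p: "prime p" and ev: "eigenform_mod L k \<epsilon> p g ev" and norm: "normalised_mod L g" for p ev
    proof
      have p0: "p > 0" using p by (rule prime_gt_0_nat)
      have "L_cong L (c (n * p) + of_nat p ^ k * (of_nat p * (of_nat p ^ kA * chiA (int p) * \<epsilon> (int p))) *
                (if p dvd n then c (n div p) else 0)) (of_nat p * a p * c n)" for n
      proof (rule hecke_eigenvalue_twist[where a = a and t = "of_nat p powi (int k - 1)"])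
        show "of_nat p * of_nat p powi (int k - 1) = (of_nat p ^ k :: complex)"
          using p0 by (simp add: power_int_diff)
        show "L_cong L (of_nat p * (of_nat p ^ kA * chiA (int p) * \<epsilon> (int p))) (of_nat p * \<epsilon> (int p))"
          by (rule character_twist[OF assms(1) place(2) p N \<epsilon> chiA assms(11)])
        show "\<epsilon> (int p) \<in> L_integers L" "of_nat p ^ kA * chiA (int p) \<in> L_integers L"
          using algebraic_int_dirichlet_char[OF \<epsilon> N] algebraic_int_dirichlet_char[OF chiA N]
          by (auto intro!: L_integers_mult L_integers_power intro: L_integers_algint)
      qed (rule a_int c_cong eigenform_modD[OF ev norm a p])+
      moreover have "of_nat p powi (int (k + kA + 2) - 1) * (\<epsilon> (int p) * chiA (int p))
                = of_nat p ^ k * (of_nat p * (of_nat p ^ kA * chiA (int p) * \<epsilon> (int p)))"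
      proof -
        have "int (k + kA + 2) - 1 = int (k + kA + 1)" by simp
        then have "of_nat p powi (int (k + kA + 2) - 1) = (of_nat p ^ (k + kA + 1) :: complex)"
          by (simp only: power_int_of_nat)
        then show ?thesis by (simp add: power_add mult_ac)
      qed
      ultimately have "L_cong L (qcoeff (hecke (k + kA + 2) (\<lambda>n. \<epsilon> n * chiA n) p (theta_tilde N kA A g)) n)
                (of_nat p * a p * c n)" for n
        by (simp only: qcoeff_eq[OF has_q_expansion_hecke[OF c p0]])
      moreover have "of_nat p * a p \<in> L_integers L"
        by (rule na_int)
      ultimately show "eigenform_mod L (k + kA + 2) (\<lambda>n. \<epsilon> n * chiA n) p (theta_tilde N kA A g)
             (reduction L (of_nat p * qcoeff g p))"
        using c_int
        by (auto simp: eigenform_mod_def L_integral_coeffs_def carrier_residue_field qcoeff_eq[OF c]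
            qcoeff_eq[OF a] reduction_mult reduction_eq_iff simp del: add_2_eq_Suc')
      have "L_cong L (c 1) (a 1)" using c_cong[of 1] by simp
      then show "normalised_mod L (theta_tilde N kA A g)"
        using norm L_cong_trans by (simp add: normalised_mod_def qcoeff_eq[OF c] qcoeff_eq[OF a])
    qed
    ultimately show ?thesis by blast
  qed

  show ?thesis
  proof (intro conjI ballI allI impI)
    show "\<exists>!F. homogeneous_decomp N g F" if "g \<in> modforms_alg N" for g
      using that homogeneous_decomp_unique[OF N] unfolding modforms_alg_def by blast
  qed (use main theta_tilde_closed[OF N A] theta_tilde_add[OF N A] theta_tilde_scale[OF N A]
         theta_tilde_homogeneous[OF N A] in \<open>blast+\<close>)
qed

end
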